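(* Let $A\in\mathbb R^{n\times n}$ and $B\in\mathbb R^{n\times m}$ be in the Jordan form $A=\operatorname{diag}(A_r,J_1(0),\dots,J_{\alpha_0}(0))$, $B=[B_r^\top\ B_0^{1\top}\ \cdots\ B_0^{\alpha_0\top}]^\top$, with $A_r\in\mathbb R^{r_0\times r_0}$ the block diagonal matrix of all Jordan blocks of nonzero eigenvalues, $J_j(0)\in\mathbb R^{r_j\times r_j}$ the Jordan blocks of the eigenvalue $0$ (zeros on the diagonal, ones on the superdiagonal), $\alpha_0$ the geometric multiplicity of the eigenvalue $0$, $B_r\in\mathbb R^{r_0\times m}$, $B_0^j\in\mathbb R^{r_j\times m}$. Consider the optimal control problem of minimizing $\bar J=\frac12\int_0^\infty(\bar x^\top\bar Q\bar x+\|v\|^2)\,dt$ subject to $\dot{\bar x}=\bar A\bar x+\bar Bv$. Let $x_{df}\in\mathbb R^n$, $x_{df}\neq0$, be a desired formation vector with $x_{df}\in\operatorname{Im}(\widetilde X)$ and $x_{df}\notin V_{+}(A)\cup V_{mg(0)\ge2}(A)$, where $V_+(A)$ is the set of eigenvectors of $A$ corresponding to eigenvalues with positive real parts and $V_{mg(0)\ge2}(A)$ is the set of eigenvectors of $A$ associated with the zero eigenvalue having Jordan blocks of size at least $2$. Then the control strategy given by the exogenous system $\dot w=F_1x+F_2w+Gv$, $u=Hw+Kv$ together with $v=-\bar B^\top P\bar x$ drives the state $x$ of the system $\dot x=Ax+Bu$ to $\operatorname{Im}(x_{df})$ under the following choice of exogenous system and performance index matrix $C$: $$H=U_{B_{\text{last}}}\in\mathbb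 R^{m\times k},\qquad [F_1\ \ F_2]=[0_{k\times n}\ \ 0_{k\times k}],$$ $$K\in\mathbb R^{m\times m},\ G\in\mathbb R^{k\times m}\ \text{ such that }\ \left(\begin{bmatrix}A&BH\\ F_1&F_2\end{bmatrix},\begin{bmatrix}BK\\ G\end{bmatrix}\right)\ \text{is stabilizable},$$ $$C=[U_{x_{df}^\top}]^\top\in\mathbb R^{(n-1)\times n},$$ where $U_{B_{\text{last}}}$ and $U_{x_{df}^\top}$ are matrices whose columns form an orthonormal basis of $\operatorname{Ker}(B_{\text{last}})$ and $\operatorname{Ker}(x_{df}^\top)$ respectively.
   Context: Notation: $B_0^j(1:r_j-1)$ denotes the first $r_j-1$ rows of $B_0^j$ and $B_0^j(r_j)$ its last row; $B_{\text{last}}\in\mathbb R^{\alpha_0\times m}$ is the matrix with rows $B_0^1(r_1),\dots,B_0^{\alpha_0}(r_{\alpha_0})$; $U_A$ is a matrix whose columns form an orthonormal basis of $\operatorname{Ker}(A)$; and $$\widetilde X=\left[\begin{array}{c|c}A_r^{-1}B_rU_{B_{\text{last}}}&\\ \widetilde X_1&\\ \vdots&U_A\\ \widetilde X_{\alpha_0}&\end{array}\right],\qquad \widetilde X_i=\begin{bmatrix}0\\ B_0^i(1:r_i-1)\,U_{B_{\text{last}}}\end{bmatrix},$$ where $U_A$ (with $n$ rows) stands to the right of the stacked left block. Setting. $x(t)\in\mathbb R^n$ is the state and $u(t)\in\mathbb R^m$ the control of the multi-agent system; $w\in\mathbb R^k$ is the state of the exogenous system and $v\in\mathbb R^p$ (here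 $p=m$) the new control. Let $Q=C^\top C$ with $C\in\mathbb R^{q\times n}$ (here $q=n-1$) and put $$\bar x=\begin{bmatrix}x\\ w\end{bmatrix},\quad \bar A=\begin{bmatrix}A&BH\\ F_1&F_2\end{bmatrix},\quad \bar B=\begin{bmatrix}BK\\ G\end{bmatrix},\quad \bar C=[\,C\ \ 0_{q\times k}\,],\quad \bar Q=\bar C^\top\bar C.$$ $P$ denotes the smallest real symmetric positive semi-definite solution of $\bar A^\top P+P\bar A-P\bar B\bar B^\top P+\bar Q=0$ (smallest: $P_0-P$ is positive semi-definite for every other real symmetric positive semi-definite solution $P_0$); it exists when $(\bar A,\bar B)$ is stabilizable, and $v^*=-\bar B^\top P\bar x$ is the optimal control. The closed-loop system is $\dot{\bar x}=(\bar A-\bar B\bar B^\top P)\bar x$. "Drives the state to $\operatorname{Im}(x_{df})$" means that along the closed-loop system, from any initial state, $x(t)$ converges as $t\to\infty$ to a vector in $\operatorname{Im}(x_{df})=\{c\,x_{df}:c\in\mathbb R\}$. *)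

theory Defs
  imports
    Complex_Main
    "Jordan_Normal_Form.Jordan_Normal_Form"
    "Jordan_Normal_Form.Gauss_Jordan_Elimination"
    "Jordan_Normal_Form.Matrix_Kernel"
begin

section \<open>Matrices\<close>

definition vcat :: "nat \<Rightarrow> 'a :: zero mat list \<Rightarrow> 'a mat" where
  "vcat nc Ms = foldr (@\<^sub>r) Ms (0\<^sub>m 0 nc)"

definition hcat :: "'a :: zero mat \<Rightarrow> 'a mat \<Rightarrow> 'a mat" where
  "hcat M N = four_block_mat M N (0\<^sub>m 0 (dim_col M)) (0\<^sub>m 0 (dim_col N))"

definition upper_rows :: "'a mat \<Rightarrow> 'a mat" where
  "upper_rows M = mat_of_rows (dim_col M) (butlast (rows M))"

definition last_row :: "'a mat \<Rightarrow> 'a vec" where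
  "last_row M = last (rows M)"

definition mat_range :: "'a :: semiring_0 mat \<Rightarrow> 'a vec set" where
  "mat_range M = {M *\<^sub>v a | a. a \<in> carrier_vec (dim_col M)}"

definition kernel_onb :: "real mat \<Rightarrow> real mat \<Rightarrow> bool" where
  "kernel_onb U M \<longleftrightarrow> dim_row U = dim_col M \<and>
     (\<forall>i<dim_col U. \<forall>j<dim_col U. col U i \<bullet> col U j = (if i = j then 1 else 0)) \<and>
     mat_range U = mat_kernel M"

abbreviation complexify :: "real mat \<Rightarrow> complex mat" where
  "complexify M \<equiv> map_mat complex_of_real M"

definition psd :: "real mat \<Rightarrow> bool" where
  "psd M \<longleftrightarrow> M \<in> carrier_mat (dim_row M) (dim_row M) \<and> M\<^sup>T = M \<and>
     (\<forall>x\<in>carrier_vec (dim_row M). 0 \<le> x \<bullet> (M *\<^sub>v x))"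


section \<open>Jordan form of a real matrix\<close>

text \<open>The real Jordan block of size \<open>2 * r\<close> of the pair of complex eigenvalues \<open>a + i b\<close>,
  \<open>a - i b\<close>: rotation-scaling blocks with rows \<open>(a, b)\<close>, \<open>(- b, a)\<close> on the diagonal and
  2-by-2 identity blocks on the superdiagonal.\<close>

definition jordan_block_pair :: "nat \<Rightarrow> real \<Rightarrow> real \<Rightarrow> real mat" where
  "jordan_block_pair r a b = mat (2 * r) (2 * r) (\<lambda>(i, j).
     if i = j then a
     else if i div 2 = j div 2 then (if even i then b else - b)
     else if j = i + 2 then 1 else 0)"

definition nonzero_jordan_block :: "real mat \<Rightarrow> bool" where
  "nonzero_jordan_block J \<longleftrightarrow>
     (\<exists>r l. r \<ge> 1 \<and> l \<noteq> 0 \<and> J = jordan_block r l) \<or>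
     (\<exists>r a b. r \<ge> 1 \<and> b \<noteq> 0 \<and> J = jordan_block_pair r a b)"

text \<open>\<open>Js\<close> are the Jordan blocks of the nonzero eigenvalues, \<open>rs\<close> the sizes of those of the
  eigenvalue 0, whose geometric multiplicity is therefore \<open>length rs\<close>.\<close>

definition jordan_form :: "real mat list \<Rightarrow> nat list \<Rightarrow> real mat" where
  "jordan_form Js rs = diag_block_mat (diag_block_mat Js # map (\<lambda>r. jordan_block r 0) rs)"

definition V_plus :: "real mat \<Rightarrow> complex vec set" where
  "V_plus A = {v. \<exists>l. 0 < Re l \<and> eigenvector (complexify A) v l}"

text \<open>For \<open>A\<close> the Jordan form whose zero blocks have sizes \<open>rs\<close> and start at row \<open>r0\<close>: the
  kernel of \<open>A\<close> is spanned by the unit vectors at the first index of each zero block, and the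
  eigenvectors that belong to the blocks of size at least 2 are those without a component in a
  block of size 1.\<close>

definition V_mg_ge2 :: "real mat \<Rightarrow> nat \<Rightarrow> nat list \<Rightarrow> complex vec set" where
  "V_mg_ge2 A r0 rs = {v. eigenvector (complexify A) v 0 \<and>
     (\<forall>j<length rs. rs ! j = 1 \<longrightarrow> v $ (r0 + sum_list (take j rs)) = 0)}"


section \<open>The matrices of the control problem\<close>

definition B_last :: "nat \<Rightarrow> real mat list \<Rightarrow> real mat" where
  "B_last m Bs = mat_of_rows m (map last_row Bs)"

definition X_tilde :: "real mat \<Rightarrow> real mat \<Rightarrow> real mat list \<Rightarrow> real mat \<Rightarrow> real mat \<Rightarrow> real mat" where
  "X_tilde A_r B_r Bs U_B U_A =
     (let k = dim_col U_B in
      hcat (vcat k ((the (mat_inverse A_r) * B_r * U_B) #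
                    map (\<lambda>M. 0\<^sub>m 1 k @\<^sub>r (upper_rows M * U_B)) Bs))
           U_A)"

definition A_bar :: "real mat \<Rightarrow> real mat \<Rightarrow> real mat \<Rightarrow> real mat \<Rightarrow> real mat \<Rightarrow> real mat" where
  "A_bar A B H F1 F2 = four_block_mat A (B * H) F1 F2"

definition B_bar :: "real mat \<Rightarrow> real mat \<Rightarrow> real mat \<Rightarrow> real mat" where
  "B_bar B K G = (B * K) @\<^sub>r G"

definition C_bar :: "real mat \<Rightarrow> nat \<Rightarrow> real mat" where
  "C_bar C k = hcat C (0\<^sub>m (dim_row C) k)"

definition hurwitz :: "real mat \<Rightarrow> bool" where
  "hurwitz M \<longleftrightarrow> (\<forall>l. eigenvalue (complexify M) l \<longrightarrow> Re l < 0)"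

definition stabilizable :: "real mat \<Rightarrow> real mat \<Rightarrow> bool" where
  "stabilizable M N \<longleftrightarrow> (\<exists>L\<in>carrier_mat (dim_col N) (dim_row M). hurwitz (M + N * L))"

definition psd_are_solution :: "real mat \<Rightarrow> real mat \<Rightarrow> real mat \<Rightarrow> real mat \<Rightarrow> bool" where
  "psd_are_solution M N Q P \<longleftrightarrow> P \<in> carrier_mat (dim_row M) (dim_row M) \<and> psd P \<and>
     M\<^sup>T * P + P * M - P * N * N\<^sup>T * P + Q = 0\<^sub>m (dim_row M) (dim_row M)"

definition smallest_psd_are_solution :: "real mat \<Rightarrow> real mat \<Rightarrow> real mat \<Rightarrow> real mat \<Rightarrow> bool" where
  "smallest_psd_are_solution M N Q P \<longleftrightarrow> psd_are_solution M N Q P \<and>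
     (\<forall>P0. psd_are_solution M N Q P0 \<longrightarrow> psd (P0 - P))"


section \<open>Trajectories\<close>

text \<open>The type of vectors of variable dimension carries no topology, so derivatives and limits
  are taken componentwise.\<close>

definition has_deriv_on_nonneg :: "nat \<Rightarrow> (real \<Rightarrow> real vec) \<Rightarrow> (real \<Rightarrow> real vec) \<Rightarrow> bool" where
  "has_deriv_on_nonneg N z z' \<longleftrightarrow> (\<forall>t\<ge>0. z t \<in> carrier_vec N \<and>
     (\<forall>i<N. ((\<lambda>s. z s $ i) has_real_derivative (z' t $ i)) (at t within {0..})))"

definition converges_to :: "nat \<Rightarrow> (real \<Rightarrow> real vec) \<Rightarrow> real vec \<Rightarrow> bool" where
  "converges_to N z y \<longleftrightarrow> (\<forall>i<N. ((\<lambda>t. z t $ i) \<longlongrightarrow> y $ i) at_top)"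

definition closed_loop :: "real mat \<Rightarrow> real mat \<Rightarrow> real mat \<Rightarrow> real mat \<Rightarrow> real mat \<Rightarrow> real mat \<Rightarrow>
    real mat \<Rightarrow> real mat \<Rightarrow> (real \<Rightarrow> real vec) \<Rightarrow> (real \<Rightarrow> real vec) \<Rightarrow> bool" where
  "closed_loop A B H F1 F2 K G P x w \<longleftrightarrow> (\<exists>u v.
     has_deriv_on_nonneg (dim_row A) x (\<lambda>t. A *\<^sub>v x t + B *\<^sub>v u t) \<and>
     has_deriv_on_nonneg (dim_row F2) w (\<lambda>t. F1 *\<^sub>v x t + F2 *\<^sub>v w t + G *\<^sub>v v t) \<and>
     (\<forall>t\<ge>0. u t = H *\<^sub>v w t + K *\<^sub>v v t) \<and>
     (\<forall>t\<ge>0. v t = - ((B_bar B K G)\<^sup>T * P *\<^sub>v (x t @\<^sub>v w t))))"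

text \<open>There is no restriction on \<open>x 0\<close> and \<open>w 0\<close>: every initial state is covered.\<close>

definition drives_to_line :: "real mat \<Rightarrow> real mat \<Rightarrow> real mat \<Rightarrow> real mat \<Rightarrow> real mat \<Rightarrow> real mat \<Rightarrow>
    real mat \<Rightarrow> real mat \<Rightarrow> real vec \<Rightarrow> bool" where
  "drives_to_line A B H F1 F2 K G P xd \<longleftrightarrow> (\<forall>x w. closed_loop A B H F1 F2 K G P x w \<longrightarrow>
     (\<exists>c. converges_to (dim_row A) x (c \<cdot>\<^sub>v xd)))"

end

theory Submission
  imports
    "HOL-Analysis.Derivative"
    "Jordan_Normal_Form.Schur_Decomposition"
    Defs
begin

text \<open>Let \<open>M = A_bar - B_bar B_bar\<^sup>T P\<close> be the matrix of the closed loop. The proof shows that every trajectory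
converges to a point of the kernel of \<open>M\<close>, and that the \<open>x\<close>-part of each kernel vector is a multiple of
\<open>x_df\<close>.

The main tool is the energy identity \<open>closed_loop_energy\<close>: along the closed loop the cost
\<open>z \<bullet> (P *\<^sub>v z)\<close> decreases at the rate of the squared norms of the output and of the control. So a
mode of \<open>M\<close> that does not decay produces no output and no control (\<open>closed_loop_unstable_mode\<close>). By
the choice of \<open>C\<close>, no output means that the \<open>x\<close>-part stays on the line through \<open>x_df\<close>; this gives the
claim about the kernel of \<open>M\<close>. Without control the exogenous state \<open>w\<close> is constant, which leaves two
ways in which convergence could fail, each tied to one of the excluded sets.

A nonzero eigenvalue with nonnegative real part would make \<open>x_df\<close> an eigenvector of \<open>A\<close> for that
eigenvalue, which would then be real and positive; \<open>V_plus\<close> excludes this.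

A Jordan chain of \<open>M\<close> at the eigenvalue 0 would make \<open>x_df\<close> a kernel vector of \<open>A\<close> in the range of \<open>B H\<close>.
Since \<open>H\<close> annihilates the last rows of the zero blocks, such a vector has no component in the blocks
of size 1; \<open>V_mg_ge2\<close> excludes this. To see that the whole chain is free of output and control one
needs that \<open>P\<close> vanishes on its end vector, an output-free equilibrium of the uncontrolled system. This is
where the minimality of \<open>P\<close> enters (\<open>smallest_are_solution_annihilates\<close>): a rank-one correction
would otherwise produce a smaller solution.

So all eigenvalues of \<open>M\<close> have negative real part, except possibly a semisimple 0. That such a flow
converges to the kernel (\<open>linear_flow_converges\<close>) is proved by back substitution in a Schur form,
which only needs estimates for scalar equations and no matrix exponential.\<close>

text \<open>Below, both symbols are reserved for vectors of variable dimension.\<close>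

no_notation Finite_Cartesian_Product.vec_nth (infixl "$" 90)
no_notation inner (infix "\<bullet>" 70)

section \<open>Scalar equations with exponentially decaying right-hand side\<close>

text \<open>The mean value inequality with an exponential majorant. It is needed with \<open>c > 0\<close> for a solution
divided by the solution of the homogeneous equation, and with \<open>c < 0\<close> for a derivative that decays.\<close>

lemma increment_le_exp:
  fixes f :: "real \<Rightarrow> complex"
  assumes deriv: "\<And>t. 0 \<le> t \<Longrightarrow> (f has_vector_derivative f' t) (at t within {0..})"
    and bound: "\<And>t. 0 \<le> t \<Longrightarrow> norm (f' t) \<le> K * exp (c * t)"
    and c: "c \<noteq> 0" and st: "0 \<le> s" "s \<le> t"
  shows "norm (f t - f s) \<le> K / c * exp (c * t) - K / c * exp (c * s)"
proof (cases "s = t")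
  case False
  with st have lt: "s < t" by simp
  show ?thesis
  proof (rule differentiable_bound_general[OF lt, where f = f and \<phi> = "\<lambda>t. K / c * exp (c * t)"
        and f' = f' and \<phi>' = "\<lambda>t. K * exp (c * t)"])
    show "continuous_on {s..t} f"
      unfolding continuous_on_eq_continuous_within
    proof
      fix x assume "x \<in> {s..t}"
      with st have "0 \<le> x" by simp
      then have "continuous (at x within {0..}) f"
        using deriv has_vector_derivative_continuous by blast
      then show "continuous (at x within {s..t}) f"
        by (rule continuous_within_subset) (use st in auto)
    qed
    show "continuous_on {s..t} (\<lambda>t. K / c * exp (c * t))"
      by (intro continuous_intros)
    fix x assume x: "s < x" "x < t"
    with st have "at x within {0..} = at x"
      by (intro at_within_interior) auto
    with deriv[of x] x st show "(f has_vector_derivative f' x) (at x)" by simp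
    show "((\<lambda>t. K / c * exp (c * t)) has_vector_derivative K * exp (c * x)) (at x)"
      unfolding has_real_derivative_iff_has_vector_derivative[symmetric]
      by (auto intro!: derivative_eq_intros simp: c)
    show "norm (f' x) \<le> K * exp (c * x)" using bound x st by simp
  qed
qed simp

definition exp_decaying :: "(real \<Rightarrow> complex) \<Rightarrow> bool" where
  "exp_decaying f \<longleftrightarrow> (\<exists>K. \<exists>e>0. \<forall>t\<ge>0. norm (f t) \<le> K * exp (- e * t))"

lemma exp_decaying_const_mult:
  assumes "exp_decaying f"
  shows "exp_decaying (\<lambda>t. c * f t)"
proof -
  obtain K e where "e > 0" and K: "\<forall>t\<ge>0. norm (f t) \<le> K * exp (- e * t)"
    using assms unfolding exp_decaying_def by blast
  have "\<forall>t\<ge>0. norm (c * f t) \<le> (norm c * K) * exp (- e * t)"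
    using K by (auto simp: norm_mult mult.assoc intro!: mult_left_mono)
  with \<open>e > 0\<close> show ?thesis unfolding exp_decaying_def by blast
qed

lemma exp_decaying_add:
  assumes "exp_decaying f" "exp_decaying g"
  shows "exp_decaying (\<lambda>t. f t + g t)"
proof -
  obtain K d where d: "d > 0" and K: "\<forall>t\<ge>0. norm (f t) \<le> K * exp (- d * t)"
    using assms(1) unfolding exp_decaying_def by blast
  obtain L e where e: "e > 0" and L: "\<forall>t\<ge>0. norm (g t) \<le> L * exp (- e * t)"
    using assms(2) unfolding exp_decaying_def by blast
  have "norm (f t + g t) \<le> (\<bar>K\<bar> + \<bar>L\<bar>) * exp (- min d e * t)" if t: "t \<ge> 0" for t
  proof -
    have "min d e * t \<le> d * t" "min d e * t \<le> e * t"
      using t by (auto intro!: mult_right_mono)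
    then have m: "exp (- d * t) \<le> exp (- min d e * t)" "exp (- e * t) \<le> exp (- min d e * t)"
      by auto
    have "norm (f t + g t) \<le> norm (f t) + norm (g t)" by (rule norm_triangle_ineq)
    also have "\<dots> \<le> \<bar>K\<bar> * exp (- d * t) + \<bar>L\<bar> * exp (- e * t)"
    proof (rule add_mono)
      show "norm (f t) \<le> \<bar>K\<bar> * exp (- d * t)"
        using K t by (meson abs_ge_self exp_ge_zero mult_right_mono order_trans)
      show "norm (g t) \<le> \<bar>L\<bar> * exp (- e * t)"
        using L t by (meson abs_ge_self exp_ge_zero mult_right_mono order_trans)
    qed
    also have "\<dots> \<le> \<bar>K\<bar> * exp (- min d e * t) + \<bar>L\<bar> * exp (- min d e * t)"
      using m by (intro add_mono mult_left_mono) auto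
    finally show ?thesis by (simp add: distrib_right)
  qed
  moreover have "min d e > 0" using d e by simp
  ultimately show ?thesis unfolding exp_decaying_def by blast
qed

lemma exp_decaying_sum:
  assumes "finite S" "\<And>j. j \<in> S \<Longrightarrow> exp_decaying (g j)"
  shows "exp_decaying (\<lambda>t. \<Sum>j\<in>S. g j t)"
  using assms
proof (induction S rule: finite_induct)
  case empty
  show ?case unfolding exp_decaying_def
    by (intro exI[of _ 0] exI[of _ 1]) simp
next
  case (insert j S)
  then show ?case by (simp add: exp_decaying_add)
qed

lemma exp_decaying_tendsto_zero:
  assumes "exp_decaying f"
  shows "(f \<longlongrightarrow> 0) at_top"
proof -
  obtain K e where e: "e > 0" and K: "\<forall>t\<ge>0. norm (f t) \<le> K * exp (- e * t)"
    using assms unfolding exp_decaying_def by blast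
  have "filterlim (\<lambda>t::real. e * t) at_top at_top"
    using e by (intro filterlim_tendsto_pos_mult_at_top[OF tendsto_const] filterlim_ident)
  then have "filterlim (\<lambda>t::real. - e * t) at_bot at_top"
    by (simp add: filterlim_uminus_at_bot)
  then have "((\<lambda>t. K * exp (- e * t)) \<longlongrightarrow> K * 0) at_top"
    by (intro tendsto_mult tendsto_const filterlim_compose[OF exp_at_bot])
  then have "((\<lambda>t. K * exp (- e * t)) \<longlongrightarrow> 0) at_top" by simp
  moreover have "\<forall>\<^sub>F t in at_top. norm (f t) \<le> K * exp (- e * t)"
    using K by (auto intro: eventually_at_top_linorderI[of 0])
  ultimately show ?thesis by (rule Lim_null_comparison[rotated])
qed

text \<open>Variation of constants: \<open>h t = exp (- l * t) * y t\<close> has derivative \<open>exp (- l * t) * g t\<close>. The forcing may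
decay faster than, slower than or exactly as fast as \<open>exp (l * t)\<close>. Giving up a little decay, to a
rate \<open>d\<close> that is at most the rate of \<open>g\<close> and strictly below \<open>- Re l\<close>, covers the resonant case too.\<close>

lemma exp_decaying_forced_stable:
  fixes y :: "real \<Rightarrow> complex"
  assumes deriv: "\<And>t. 0 \<le> t \<Longrightarrow> (y has_vector_derivative l * y t + g t) (at t within {0..})"
    and l: "Re l < 0" and g: "exp_decaying g"
  shows "exp_decaying y"
proof -
  obtain K e where e: "e > 0" and K: "\<forall>t\<ge>0. norm (g t) \<le> K * exp (- e * t)"
    using g unfolding exp_decaying_def by blast
  have "norm (g 0) \<le> K" using K[rule_format, of 0] by simp
  then have K0: "K \<ge> 0" using norm_ge_zero order_trans by blast
  define d where "d = min e (- Re l / 2)"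
  define c where "c = - Re l - d"
  have d: "d > 0" "d \<le> e" and c: "c > 0" using e l by (auto simp: d_def c_def min_def)
  \<comment> \<open>with this \<open>d\<close> the derivative of \<open>h\<close> is bounded by a growing exponential of rate \<open>c > 0\<close>\<close>
  define h where "h = (\<lambda>t. exp (- l * of_real t) * y t)"
  have h': "(h has_vector_derivative exp (- l * of_real t) * g t) (at t within {0..})"
    if "0 \<le> t" for t
  proof -
    have E: "((\<lambda>t. exp (- l * complex_of_real t)) has_vector_derivative
        - l * exp (- l * of_real t)) (at t within {0..})"
      by (rule has_vector_derivative_real_field) (auto intro!: derivative_eq_intros)
    have "(h has_vector_derivative exp (- l * of_real t) * (l * y t + g t)
        + (- l * exp (- l * of_real t)) * y t) (at t within {0..})"
      unfolding h_def by (rule has_vector_derivative_mult[OF E deriv[OF that]])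
    then show ?thesis by (simp add: algebra_simps)
  qed
  have hb: "norm (exp (- l * of_real t) * g t) \<le> K * exp (c * t)" if t: "0 \<le> t" for t
  proof -
    have "norm (exp (- l * of_real t) * g t) = exp (- Re l * t) * norm (g t)"
      by (simp add: norm_mult)
    also have "\<dots> \<le> exp (- Re l * t) * (K * exp (- e * t))"
      using K t by (intro mult_left_mono) auto
    also have "\<dots> = K * exp ((- Re l - e) * t)"
      by (simp add: algebra_simps flip: exp_add)
    also have "\<dots> \<le> K * exp (c * t)"
    proof -
      have "(- Re l - e) * t \<le> c * t" using d t by (intro mult_right_mono) (auto simp: c_def)
      then show ?thesis using K0 by (intro mult_left_mono) auto
    qed
    finally show ?thesis .
  qed
  have "norm (y t) \<le> (norm (y 0) + K / c) * exp (- d * t)" if t: "0 \<le> t" for t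
  proof -
    have "norm (h t - h 0) \<le> K / c * exp (c * t) - K / c * exp (c * 0)"
      using c t by (intro increment_le_exp[OF h' hb]) auto
    also have "\<dots> \<le> K / c * exp (c * t)" using K0 c by simp
    finally have "norm (h t) \<le> norm (h 0) + K / c * exp (c * t)"
      using norm_triangle_sub[of "h t" "h 0"] by linarith
    also have "\<dots> \<le> norm (y 0) * exp (c * t) + K / c * exp (c * t)"
    proof -
      have "1 \<le> exp (c * t)" using c t by simp
      then have "norm (y 0) * 1 \<le> norm (y 0) * exp (c * t)" by (rule mult_left_mono) simp
      then show ?thesis by (simp add: h_def)
    qed
    finally have hn: "norm (h t) \<le> (norm (y 0) + K / c) * exp (c * t)"
      by (simp add: distrib_right)
    have "y t = exp (l * of_real t) * h t"
      by (simp add: h_def mult.assoc[symmetric] flip: exp_add)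
    then have "norm (y t) = exp (Re l * t) * norm (h t)" by (simp add: norm_mult)
    also have "\<dots> \<le> exp (Re l * t) * ((norm (y 0) + K / c) * exp (c * t))"
      using hn by (intro mult_left_mono) auto
    also have "\<dots> = (norm (y 0) + K / c) * exp (- d * t)"
      by (simp add: c_def algebra_simps flip: exp_add)
    finally show ?thesis .
  qed
  then show ?thesis unfolding exp_decaying_def using d by blast
qed

text \<open>An exponentially decaying function is integrable on the half line: \<open>K / e * exp (- e * s)\<close> bounds all
later increments of \<open>y\<close> after time \<open>s\<close>.\<close>

lemma exp_decaying_deriv_converges:
  fixes y :: "real \<Rightarrow> complex"
  assumes deriv: "\<And>t. 0 \<le> t \<Longrightarrow> (y has_vector_derivative g t) (at t within {0..})"
    and g: "exp_decaying g"
  shows "\<exists>L. (y \<longlongrightarrow> L) at_top"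
proof -
  obtain K e where e: "e > 0" and K: "\<And>t. t \<ge> 0 \<Longrightarrow> norm (g t) \<le> K * exp (- e * t)"
    using g unfolding exp_decaying_def by blast
  have "norm (g 0) \<le> K" using K[of 0] by simp
  then have K0: "K \<ge> 0" using norm_ge_zero order_trans by blast
  define \<phi> where "\<phi> = (\<lambda>t. complex_of_real (K / e * exp (- e * t)))"
  have inc: "norm (y t - y s) \<le> norm (\<phi> s)" if st: "0 \<le> s" "s \<le> t" for s t
  proof -
    have "norm (y t - y s) \<le> K / (- e) * exp (- e * t) - K / (- e) * exp (- e * s)"
      using e by (intro increment_le_exp[OF deriv K _ st]) auto
    also have "\<dots> \<le> K / e * exp (- e * s)" using K0 e by simp
    also have "\<dots> = norm (\<phi> s)" using K0 e by (simp add: \<phi>_def norm_mult norm_divide)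
    finally show ?thesis .
  qed
  have "exp_decaying \<phi>"
    unfolding exp_decaying_def \<phi>_def
    using K0 e by (intro exI[of _ "K / e"] exI[of _ e]) (simp add: norm_mult norm_divide)
  then have \<phi>0: "(\<phi> \<longlongrightarrow> 0) at_top" by (rule exp_decaying_tendsto_zero)
  have "Cauchy (\<lambda>n. y (real n))"
  proof (rule metric_CauchyI)
    fix r :: real assume r: "0 < r"
    have "\<forall>\<^sub>F t in at_top. norm (\<phi> t) < r / 2"
      using tendstoD[OF \<phi>0, of "r / 2"] r by simp
    then obtain M where M: "\<And>t. t \<ge> M \<Longrightarrow> norm (\<phi> t) < r / 2"
      unfolding eventually_at_top_linorder by blast
    define m where "m = nat \<lceil>M\<rceil>"
    have m: "real m \<ge> M" unfolding m_def by linarith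
    have "dist (y (real p)) (y (real q)) < r" if "p \<ge> m" "q \<ge> m" for p q
    proof -
      have "dist (y (real i)) (y (real m)) < r / 2" if "i \<ge> m" for i
        using inc[of "real m" "real i"] that M[OF m] by (simp add: dist_norm)
      from this[OF \<open>p \<ge> m\<close>] this[OF \<open>q \<ge> m\<close>] show ?thesis
        by (rule dist_triangle_half_l)
    qed
    then show "\<exists>M. \<forall>m\<ge>M. \<forall>n\<ge>M. dist (y (real m)) (y (real n)) < r" by blast
  qed
  then obtain L where L: "(\<lambda>n. y (real n)) \<longlonglongrightarrow> L"
    using Cauchy_convergent_iff convergent_def by blast
  have "norm (y t - L) \<le> norm (\<phi> t)" if t: "t \<ge> 0" for t
  proof (rule LIMSEQ_le_const2)
    show "(\<lambda>n. norm (y t - y (real n))) \<longlonglongrightarrow> norm (y t - L)"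
      by (intro tendsto_intros L)
    have "norm (y t - y (real n)) \<le> norm (\<phi> t)" if "n \<ge> nat \<lceil>t\<rceil>" for n
      using inc[OF t, of "real n"] that by (simp add: norm_minus_commute)
    then show "\<exists>N. \<forall>n\<ge>N. norm (y t - y (real n)) \<le> norm (\<phi> t)" by blast
  qed
  then have "\<forall>\<^sub>F t in at_top. norm (y t - L) \<le> norm (\<phi> t)"
    by (auto intro: eventually_at_top_linorderI[of 0])
  then have "((\<lambda>t. y t - L) \<longlongrightarrow> 0) at_top"
    by (rule Lim_null_comparison) (use tendsto_norm_zero[OF \<phi>0] in simp)
  then show ?thesis using LIM_zero_iff by blast
qed

section \<open>Convergence of linear flows\<close>

text \<open>Back substitution. The components from \<open>d\<close> on form a stable triangular system and decay, from the
last one upwards, each being forced by the later ones. The first \<open>d\<close> components are driven by the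
decaying ones only, because the leading \<open>d\<close> by \<open>d\<close> block vanishes, so they converge. The limit is
supported on the first \<open>d\<close> coordinates, whose columns are zero, hence lies in the kernel.\<close>

lemma upper_triangular_flow_converges:
  fixes T :: "complex mat" and \<zeta> :: "real \<Rightarrow> complex vec"
  assumes T: "T \<in> carrier_mat N N" "upper_triangular T"
    and zero: "\<And>i j. i < d \<Longrightarrow> j < d \<Longrightarrow> i < N \<Longrightarrow> j < N \<Longrightarrow> T $$ (i, j) = 0"
    and stable: "\<And>i. d \<le> i \<Longrightarrow> i < N \<Longrightarrow> Re (T $$ (i, i)) < 0"
    and \<zeta>: "\<And>t. 0 \<le> t \<Longrightarrow> \<zeta> t \<in> carrier_vec N"
    and deriv: "\<And>t i. 0 \<le> t \<Longrightarrow> i < N \<Longrightarrow>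
      ((\<lambda>s. \<zeta> s $ i) has_vector_derivative (T *\<^sub>v \<zeta> t) $ i) (at t within {0..})"
  shows "\<exists>l\<in>carrier_vec N. T *\<^sub>v l = 0\<^sub>v N \<and> (\<forall>i<N. ((\<lambda>t. \<zeta> t $ i) \<longlongrightarrow> l $ i) at_top)"
proof -
  have mult: "(T *\<^sub>v v) $ i = (\<Sum>j\<in>{0..<N}. T $$ (i, j) * v $ j)"
    if "i < N" "v \<in> carrier_vec N" for i v
    using that T by (simp add: scalar_prod_def)
  have decay: "exp_decaying (\<lambda>t. \<zeta> t $ i)" if "d \<le> i" "i < N" for i
    using that
  proof (induction "N - i" arbitrary: i rule: less_induct)
    case less
    define g where "g = (\<lambda>t. \<Sum>j\<in>{i<..<N}. T $$ (i, j) * \<zeta> t $ j)"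
    have g: "exp_decaying g" unfolding g_def
      using less by (intro exp_decaying_sum exp_decaying_const_mult) auto
    have "(T *\<^sub>v \<zeta> t) $ i = T $$ (i, i) * \<zeta> t $ i + g t" if t: "0 \<le> t" for t
    proof -
      have "(T *\<^sub>v \<zeta> t) $ i = (\<Sum>j\<in>{i..<N}. T $$ (i, j) * \<zeta> t $ j)"
        unfolding mult[OF less.prems(2) \<zeta>[OF t]]
        using T less.prems by (intro sum.mono_neutral_right) auto
      also have "{i..<N} = insert i {i<..<N}" using less.prems by auto
      finally show ?thesis by (simp add: g_def)
    qed
    with deriv[OF _ less.prems(2)]
    have "((\<lambda>s. \<zeta> s $ i) has_vector_derivative T $$ (i, i) * \<zeta> t $ i + g t) (at t within {0..})"
      if "0 \<le> t" for t
      using that by metis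
    then show ?case
      by (rule exp_decaying_forced_stable[OF _ stable[OF less.prems] g])
  qed
  have lim: "\<exists>L. ((\<lambda>t. \<zeta> t $ i) \<longlongrightarrow> L) at_top \<and> (d \<le> i \<longrightarrow> L = 0)" if i: "i < N" for i
  proof (cases "d \<le> i")
    case True
    then show ?thesis using exp_decaying_tendsto_zero[OF decay] i by blast
  next
    case False
    define g where "g = (\<lambda>t. \<Sum>j\<in>{d..<N}. T $$ (i, j) * \<zeta> t $ j)"
    have g: "exp_decaying g" unfolding g_def
      using decay by (intro exp_decaying_sum exp_decaying_const_mult) auto
    have "(T *\<^sub>v \<zeta> t) $ i = g t" if t: "0 \<le> t" for t
      unfolding mult[OF i \<zeta>[OF t]] g_def
      using False zero[of i] i by (intro sum.mono_neutral_right) auto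
    with deriv[OF _ i]
    have "((\<lambda>s. \<zeta> s $ i) has_vector_derivative g t) (at t within {0..})" if "0 \<le> t" for t
      using that by metis
    then show ?thesis using exp_decaying_deriv_converges[OF _ g] False by blast
  qed
  then obtain L where L: "\<And>i. i < N \<Longrightarrow> ((\<lambda>t. \<zeta> t $ i) \<longlongrightarrow> L i) at_top"
      "\<And>i. i < N \<Longrightarrow> d \<le> i \<Longrightarrow> L i = 0"
    by metis
  have "T *\<^sub>v vec N L = 0\<^sub>v N"
  proof (rule eq_vecI)
    fix i assume "i < dim_vec (0\<^sub>v N :: complex vec)"
    then have i: "i < N" by simp
    have "T $$ (i, j) * L j = 0" if "j < N" for j
    proof (cases "d \<le> j")
      case False
      then have "T $$ (i, j) = 0"
        using zero[of i j] upper_triangularD[OF T(2), of j i] T(1) that i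
        by (cases "i < d") auto
      then show ?thesis by simp
    qed (use L(2) that in simp)
    then have "(\<Sum>j = 0..<N. T $$ (i, j) * L j) = 0" by (intro sum.neutral) auto
    then show "(T *\<^sub>v vec N L) $ i = (0\<^sub>v N :: complex vec) $ i"
      unfolding mult[OF i vec_carrier] using i by simp
  qed (use T in simp)
  then show ?thesis using L(1) by (intro bexI[of _ "vec N L"]) auto
qed

lemma prod_list_filter_partition:
  fixes f :: "'a \<Rightarrow> 'b :: comm_monoid_mult"
  shows "(\<Prod>a\<leftarrow>filter R as @ filter (\<lambda>a. \<not> R a) as. f a) = (\<Prod>a\<leftarrow>as. f a)"
  by (induction as) (auto simp: ac_simps)

lemma Re_complexify_mult:
  assumes "M \<in> carrier_mat nr nc" "v \<in> carrier_vec nc"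
  shows "map_vec Re (complexify M *\<^sub>v v) = M *\<^sub>v map_vec Re v"
    and "map_vec Im (complexify M *\<^sub>v v) = M *\<^sub>v map_vec Im v"
  using assms by (auto intro!: eq_vecI sum.cong simp: scalar_prod_def)

lemma complex_vec_eqI:
  assumes "dim_vec v = dim_vec w" "map_vec Re v = map_vec Re w" "map_vec Im v = map_vec Im w"
  shows "v = w"
proof (rule eq_vecI)
  fix i assume i: "i < dim_vec w"
  have "Re (v $ i) = map_vec Re v $ i" "Im (v $ i) = map_vec Im v $ i" using i assms(1) by auto
  then show "v $ i = w $ i" using i assms(2,3) by (intro complex_eqI) auto
qed (rule assms(1))

text \<open>In a Schur form with the zero eigenvalues first, the leading block is strictly upper triangular, and
semisimplicity of the eigenvalue 0 forces it to vanish. This brings the system into the shape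
treated by \<open>upper_triangular_flow_converges\<close>.\<close>

lemma linear_flow_converges:
  fixes M :: "real mat" and z :: "real \<Rightarrow> real vec"
  assumes M: "M \<in> carrier_mat N N"
    and spectrum: "\<And>l. eigenvalue (complexify M) l \<Longrightarrow> Re l < 0 \<or> l = 0"
    and semisimple: "\<And>v. v \<in> carrier_vec N \<Longrightarrow> M *\<^sub>v (M *\<^sub>v v) = 0\<^sub>v N \<Longrightarrow> M *\<^sub>v v = 0\<^sub>v N"
    and z: "has_deriv_on_nonneg N z (\<lambda>t. M *\<^sub>v z t)"
  shows "\<exists>l\<in>carrier_vec N. M *\<^sub>v l = 0\<^sub>v N \<and> converges_to N z l"
proof -
  let ?M = "complexify M"
  have cM: "?M \<in> carrier_mat N N" using M by simp
  obtain as where as: "char_poly ?M = (\<Prod>a\<leftarrow>as. [:- a, 1:])" "length as = N"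
    using char_poly_factorized[OF cM] by blast
  define es where "es = filter (\<lambda>a. a = 0) as @ filter (\<lambda>a. a \<noteq> 0) as"
  define d where "d = length (filter (\<lambda>a. a = 0) as)"
  have es: "char_poly ?M = (\<Prod>a\<leftarrow>es. [:- a, 1:])"
    unfolding es_def prod_list_filter_partition as(1) ..
  have len: "length es = N"
    unfolding es_def length_append sum_length_filter_compl as(2) ..
  obtain T P Q where "schur_decomposition ?M es = (T, P, Q)" by (cases "schur_decomposition ?M es")
  then have sim: "similar_mat_wit ?M T P Q" and ut: "upper_triangular T" and diag: "diag_mat T = es"
    using schur_decomposition[OF cM es] by auto
  note [simp] = similar_mat_witD2(5-7)[OF cM sim]
  note [simp] = this[THEN mult_mat_vec_carrier]
  note PQ = similar_mat_witD2(1-3)[OF cM sim]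
  have Tdiag: "T $$ (i, i) = es ! i" if "i < N" for i
  proof -
    have "es ! i = diag_mat T ! i" using diag by simp
    also have "\<dots> = T $$ (i, i)"
      using that carrier_matD(1)[OF similar_mat_witD2(5)[OF cM sim]] by (simp add: diag_mat_def)
    finally show ?thesis by simp
  qed
  have QPv: "Q *\<^sub>v (P *\<^sub>v v) = v" "P *\<^sub>v (Q *\<^sub>v v) = v" if "v \<in> carrier_vec N" for v
    using that PQ(1,2) by (simp_all flip: assoc_mult_mat_vec[of _ N N _ N])
  have Mv: "?M *\<^sub>v v = P *\<^sub>v (T *\<^sub>v (Q *\<^sub>v v))" if "v \<in> carrier_vec N" for v
    unfolding PQ(3) using that
    by (simp add: assoc_mult_mat_vec[of _ N N _ N] mult_carrier_mat[of P N N T N])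
  have MP: "?M *\<^sub>v (P *\<^sub>v v) = P *\<^sub>v (T *\<^sub>v v)" if "v \<in> carrier_vec N" for v
    using that by (simp add: Mv QPv)

  \<comment> \<open>semisimplicity of 0 passes from \<open>M\<close> over the reals to the similar complex matrix \<open>T\<close>\<close>
  have Tsemi: "T *\<^sub>v v = 0\<^sub>v N" if v: "v \<in> carrier_vec N" and TT: "T *\<^sub>v (T *\<^sub>v v) = 0\<^sub>v N" for v
  proof -
    define u where "u = P *\<^sub>v v"
    have u: "u \<in> carrier_vec N" unfolding u_def using v by simp
    have Mu: "?M *\<^sub>v u \<in> carrier_vec N" using u cM by simp
    have P0: "P *\<^sub>v 0\<^sub>v N = 0\<^sub>v N" by (intro eq_vecI) (auto simp: carrier_matD[of P N N])
    have "?M *\<^sub>v (?M *\<^sub>v u) = 0\<^sub>v N" unfolding u_def using v TT by (simp add: MP P0)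
    then have "map_vec Re (?M *\<^sub>v (?M *\<^sub>v u)) = 0\<^sub>v N" "map_vec Im (?M *\<^sub>v (?M *\<^sub>v u)) = 0\<^sub>v N"
      by (auto intro: eq_vecI)
    then have "M *\<^sub>v (M *\<^sub>v map_vec Re u) = 0\<^sub>v N" "M *\<^sub>v (M *\<^sub>v map_vec Im u) = 0\<^sub>v N"
      unfolding Re_complexify_mult[OF M Mu] Re_complexify_mult[OF M u] by auto
    then have "M *\<^sub>v map_vec Re u = 0\<^sub>v N" "M *\<^sub>v map_vec Im u = 0\<^sub>v N"
      using u by (auto intro!: semisimple)
    then have "?M *\<^sub>v u = 0\<^sub>v N"
      using M by (intro complex_vec_eqI) (auto simp: Re_complexify_mult[OF M u] intro: eq_vecI)
    then have "P *\<^sub>v (T *\<^sub>v v) = 0\<^sub>v N" unfolding u_def MP[OF v] .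
    then have "Q *\<^sub>v (P *\<^sub>v (T *\<^sub>v v)) = Q *\<^sub>v 0\<^sub>v N" by simp
    moreover have "Q *\<^sub>v 0\<^sub>v N = 0\<^sub>v N" by (intro eq_vecI) (auto simp: carrier_matD[of Q N N])
    ultimately show ?thesis using v by (simp add: QPv)
  qed
  have column: "T *\<^sub>v unit_vec N j = col T j" if "j < N" for j
    using that by (intro eq_vecI) (auto simp: carrier_matD[of T N N])
  \<comment> \<open>\<open>T\<close> maps \<open>unit_vec N j\<close> into the span of the earlier unit vectors, which it kills by induction;
    so \<open>T\<close> applied twice kills \<open>unit_vec N j\<close>, and by semisimplicity \<open>T\<close> does\<close>
  have zero_columns: "col T j = 0\<^sub>v N" if "j < d" "j < N" for j
    using that
  proof (induction j rule: less_induct)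
    case (less j)
    have jj: "T $$ (j, j) = 0"
    proof -
      have "es ! j = filter (\<lambda>a. a = 0) as ! j"
        using less.prems unfolding es_def d_def by (simp add: nth_append)
      also have "\<dots> = 0" using nth_mem[of j "filter (\<lambda>a. a = 0) as"] less.prems
        unfolding d_def by auto
      finally show ?thesis using Tdiag less.prems by simp
    qed
    have "T *\<^sub>v (T *\<^sub>v unit_vec N j) = 0\<^sub>v N"
    proof (rule eq_vecI)
      fix i assume "i < dim_vec (0\<^sub>v N :: complex vec)"
      then have i: "i < N" by simp
      have "T $$ (i, k) * T $$ (k, j) = 0" if k: "k < N" for k
      proof (cases rule: linorder_cases[of k j])
        case less': less
        then have "col T k = 0\<^sub>v N" using less by simp
        then have "col T k $ i = 0" using i by simp
        then show ?thesis using i k by (simp add: carrier_matD[of T N N])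
      next
        case greater
        then show ?thesis using upper_triangularD[OF ut, of j k] k
          by (simp add: carrier_matD[of T N N])
      qed (simp add: jj)
      then have "(\<Sum>k\<in>{0..<N}. T $$ (i, k) * T $$ (k, j)) = 0" by (intro sum.neutral) auto
      then show "(T *\<^sub>v (T *\<^sub>v unit_vec N j)) $ i = (0\<^sub>v N :: complex vec) $ i"
        unfolding column[OF less.prems(2)] using i less.prems
        by (simp add: scalar_prod_def carrier_matD[of T N N])
    qed (simp add: carrier_matD[of T N N])
    then show ?case using Tsemi[of "unit_vec N j"] column[OF less.prems(2)] by simp
  qed

  define \<zeta> where "\<zeta> = (\<lambda>t. Q *\<^sub>v map_vec complex_of_real (z t))"
  have zt: "z t \<in> carrier_vec N" if "0 \<le> t" for t
    using z that unfolding has_deriv_on_nonneg_def by blast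
  have \<zeta>t: "\<zeta> t \<in> carrier_vec N" if "0 \<le> t" for t
    using zt[OF that] unfolding \<zeta>_def by simp
  have "((\<lambda>s. \<zeta> s $ i) has_vector_derivative (T *\<^sub>v \<zeta> t) $ i) (at t within {0..})"
    if t: "0 \<le> t" and i: "i < N" for t i
  proof -
    define y where "y = map_vec complex_of_real (M *\<^sub>v z t)"
    have "((\<lambda>s. \<Sum>j\<in>{0..<N}. Q $$ (i, j) * complex_of_real (z s $ j)) has_vector_derivative
        (\<Sum>j\<in>{0..<N}. Q $$ (i, j) * complex_of_real ((M *\<^sub>v z t) $ j))) (at t within {0..})"
    proof (rule has_vector_derivative_sum)
      fix j assume "j \<in> {0..<N}"
      then have "((\<lambda>s. z s $ j) has_real_derivative (M *\<^sub>v z t) $ j) (at t within {0..})"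
        using z t unfolding has_deriv_on_nonneg_def by simp
      then show "((\<lambda>s. Q $$ (i, j) * complex_of_real (z s $ j)) has_vector_derivative
          Q $$ (i, j) * complex_of_real ((M *\<^sub>v z t) $ j)) (at t within {0..})"
        by (intro has_vector_derivative_mult_right has_vector_derivative_of_real
            has_real_derivative_iff_has_vector_derivative[THEN iffD1])
    qed
    also have "(\<Sum>j\<in>{0..<N}. Q $$ (i, j) * complex_of_real ((M *\<^sub>v z t) $ j)) = (Q *\<^sub>v y) $ i"
      using i M by (simp add: y_def scalar_prod_def carrier_matD[of Q N N])
    also have "y = ?M *\<^sub>v map_vec complex_of_real (z t)"
      unfolding y_def using of_real_hom.mult_mat_vec_hom[OF M zt[OF t]] .
    also have "Q *\<^sub>v \<dots> = T *\<^sub>v \<zeta> t"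
      using zt[OF t] by (simp add: Mv QPv \<zeta>_def)
    finally have D: "((\<lambda>s. \<Sum>j\<in>{0..<N}. Q $$ (i, j) * complex_of_real (z s $ j)) has_vector_derivative
        (T *\<^sub>v \<zeta> t) $ i) (at t within {0..})" .
    show ?thesis
      by (rule has_vector_derivative_transform[OF _ _ D])
        (use t i in \<open>auto simp: \<zeta>_def scalar_prod_def carrier_matD[of Q N N] carrier_vecD[OF zt]\<close>)
  qed
  moreover have "T $$ (i, j) = 0" if "i < d" "j < d" "i < N" "j < N" for i j
  proof -
    have "col T j $ i = (0\<^sub>v N :: complex vec) $ i" using zero_columns that by simp
    then show ?thesis using that by (simp add: carrier_matD[of T N N])
  qed
  moreover have "Re (T $$ (i, i)) < 0" if "d \<le> i" "i < N" for i
  proof -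
    have "es ! i = filter (\<lambda>a. a \<noteq> 0) as ! (i - d)" "i - d < length (filter (\<lambda>a. a \<noteq> 0) as)"
      using that len unfolding es_def d_def by (auto simp: nth_append)
    then have "es ! i \<in> set as" "es ! i \<noteq> 0"
      using nth_mem[of "i - d" "filter (\<lambda>a. a \<noteq> 0) as"] by auto
    moreover from this(1) have "eigenvalue ?M (es ! i)"
      unfolding eigenvalue_root_char_poly[OF cM] as(1) poly_prod_list prod_list_zero_iff by force
    ultimately show ?thesis using spectrum Tdiag[OF that(2)] by auto
  qed
  ultimately obtain l where l: "l \<in> carrier_vec N" "T *\<^sub>v l = 0\<^sub>v N"
      "\<And>i. i < N \<Longrightarrow> ((\<lambda>t. \<zeta> t $ i) \<longlongrightarrow> l $ i) at_top"
    using upper_triangular_flow_converges[OF similar_mat_witD2(5)[OF cM sim] ut, of d \<zeta>] \<zeta>t by blast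
  have Pl: "P *\<^sub>v l \<in> carrier_vec N" using l by simp
  have "M *\<^sub>v map_vec Re (P *\<^sub>v l) = map_vec Re (?M *\<^sub>v (P *\<^sub>v l))"
    by (rule Re_complexify_mult(1)[OF M Pl, symmetric])
  also have "\<dots> = map_vec Re (P *\<^sub>v 0\<^sub>v N)" using l by (simp add: MP)
  also have "\<dots> = 0\<^sub>v N" by (intro eq_vecI) (auto simp: carrier_matD[of P N N])
  finally have kernel: "M *\<^sub>v map_vec Re (P *\<^sub>v l) = 0\<^sub>v N" .
  have "((\<lambda>t. z t $ i) \<longlongrightarrow> map_vec Re (P *\<^sub>v l) $ i) at_top" if i: "i < N" for i
  proof -
    have "((\<lambda>t. \<Sum>j\<in>{0..<N}. P $$ (i, j) * \<zeta> t $ j) \<longlongrightarrow> (\<Sum>j\<in>{0..<N}. P $$ (i, j) * l $ j)) at_top"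
      using l(3) by (intro tendsto_intros) auto
    then have lim: "((\<lambda>t. Re (\<Sum>j\<in>{0..<N}. P $$ (i, j) * \<zeta> t $ j)) \<longlongrightarrow>
        Re (\<Sum>j\<in>{0..<N}. P $$ (i, j) * l $ j)) at_top"
      by (rule tendsto_Re)
    have "Re (\<Sum>j\<in>{0..<N}. P $$ (i, j) * \<zeta> t $ j) = z t $ i" if t: "0 \<le> t" for t
    proof -
      have "(\<Sum>j\<in>{0..<N}. P $$ (i, j) * \<zeta> t $ j) = (P *\<^sub>v \<zeta> t) $ i"
        using i \<zeta>t[OF t] by (simp add: scalar_prod_def carrier_matD[of P N N])
      also have "P *\<^sub>v \<zeta> t = map_vec complex_of_real (z t)"
        using zt[OF t] by (simp add: \<zeta>_def QPv)
      finally show ?thesis using i zt[OF t] by simp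
    qed
    then have "\<forall>\<^sub>F t in at_top. Re (\<Sum>j\<in>{0..<N}. P $$ (i, j) * \<zeta> t $ j) = z t $ i"
      by (auto intro: eventually_at_top_linorderI[of 0])
    from Lim_transform_eventually[OF lim this]
    show ?thesis using i l(1) by (simp add: scalar_prod_def carrier_matD[of P N N])
  qed
  with kernel Pl show ?thesis unfolding converges_to_def
    by (intro bexI[of _ "map_vec Re (P *\<^sub>v l)"]) auto
qed

section \<open>The algebraic Riccati equation\<close>

lemma scalar_prod_self_nonneg: "0 \<le> (v :: real vec) \<bullet> v"
  by (simp add: scalar_prod_def sum_nonneg)

lemma scalar_prod_self_eq_0:
  assumes "(v :: real vec) \<bullet> v = 0"
  shows "v = 0\<^sub>v (dim_vec v)"
proof (rule eq_vecI)
  fix i assume "i < dim_vec (0\<^sub>v (dim_vec v) :: real vec)"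
  then show "v $ i = (0\<^sub>v (dim_vec v) :: real vec) $ i"
    using assms by (simp add: scalar_prod_def sum_nonneg_eq_0_iff)
qed simp

lemma psd_symmetric:
  assumes "psd P" "P \<in> carrier_mat N N" "x \<in> carrier_vec N" "y \<in> carrier_vec N"
  shows "x \<bullet> (P *\<^sub>v y) = y \<bullet> (P *\<^sub>v x)"
proof -
  have "x \<bullet> (P *\<^sub>v y) = (P\<^sup>T *\<^sub>v x) \<bullet> y"
    using assms by (simp add: transpose_vec_mult_scalar)
  also have "P\<^sup>T = P" using assms(1) unfolding psd_def by blast
  also have "(P *\<^sub>v x) \<bullet> y = y \<bullet> (P *\<^sub>v x)"
    by (rule comm_scalar_prod) (use assms in auto)
  finally show ?thesis .
qed

lemma psd_nonneg:
  assumes "psd P" "P \<in> carrier_mat N N" "x \<in> carrier_vec N"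
  shows "0 \<le> x \<bullet> (P *\<^sub>v x)"
  using assms unfolding psd_def by auto

text \<open>The quadratic form is nonnegative along the line \<open>y - t \<cdot>\<^sub>v g\<close> with \<open>g = P *\<^sub>v y\<close>, where its linear
coefficient is \<open>- 2 * (g \<bullet> g)\<close>; if it vanishes at \<open>t = 0\<close>, that coefficient must be 0.\<close>

lemma psd_zero_form:
  assumes P: "psd P" "P \<in> carrier_mat N N" and y: "y \<in> carrier_vec N"
    and zero: "y \<bullet> (P *\<^sub>v y) = 0"
  shows "P *\<^sub>v y = 0\<^sub>v N"
proof -
  define g where "g = P *\<^sub>v y"
  have g: "g \<in> carrier_vec N" unfolding g_def using P(2) y by simp
  define a b where "a = g \<bullet> g" and "b = g \<bullet> (P *\<^sub>v g)"
  have b: "b \<ge> 0" unfolding b_def by (rule psd_nonneg[OF P g])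
  have a0: "a \<ge> 0" unfolding a_def by (rule scalar_prod_self_nonneg)
  have Pg: "P *\<^sub>v g \<in> carrier_vec N" using P(2) g by simp
  have yPg: "y \<bullet> (P *\<^sub>v g) = a"
    unfolding a_def by (subst psd_symmetric[OF P y g]) (simp add: g_def)
  have form: "0 \<le> t * (t * b - 2 * a)" for t
  proof -
    have "0 \<le> (y - t \<cdot>\<^sub>v g) \<bullet> (P *\<^sub>v (y - t \<cdot>\<^sub>v g))"
      using y g by (intro psd_nonneg[OF P]) auto
    also have "P *\<^sub>v (y - t \<cdot>\<^sub>v g) = g - t \<cdot>\<^sub>v (P *\<^sub>v g)"
      using P(2) y g by (simp add: mult_minus_distrib_mat_vec[of P N N] mult_mat_vec[of P N N] g_def)
    also have "(y - t \<cdot>\<^sub>v g) \<bullet> (g - t \<cdot>\<^sub>v (P *\<^sub>v g)) =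
        y \<bullet> g - t * a - t * (a - t * b)"
      using y g Pg yPg
      by (simp add: minus_scalar_prod_distrib[of _ N] scalar_prod_minus_distrib[of _ N]
          a_def b_def algebra_simps)
    also have "y \<bullet> g = 0" unfolding g_def by (rule zero)
    finally show ?thesis by (simp add: algebra_simps)
  qed
  have "a = 0"
  proof (rule ccontr)
    assume "a \<noteq> 0"
    with a0 have a: "a > 0" by simp
    \<comment> \<open>small enough that the linear term dominates, also if \<open>b = 0\<close>\<close>
    define t where "t = a / (b + 1)"
    have t: "t > 0" unfolding t_def using a b by simp
    have "t * b \<le> a" unfolding t_def using a b by (simp add: field_simps)
    then have "t * b - 2 * a < 0" using a by simp
    then have "t * (t * b - 2 * a) < 0" using t by (rule mult_pos_neg[rotated])
    with form[of t] show False by simp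
  qed
  then show ?thesis
    using scalar_prod_self_eq_0[of g] carrier_vecD[OF g] unfolding a_def g_def by simp
qed

text \<open>As an identity of bilinear forms the Riccati equation involves no matrix products, and the
candidate solution constructed below can be checked by comparing scalars.\<close>

lemma are_solution_weak_form:
  assumes A: "A \<in> carrier_mat N N" and B: "B \<in> carrier_mat N p" and C: "C \<in> carrier_mat q N"
    and P: "P \<in> carrier_mat N N" "psd P"
  shows "psd_are_solution A B (C\<^sup>T * C) P \<longleftrightarrow>
    (\<forall>x\<in>carrier_vec N. \<forall>y\<in>carrier_vec N.
      (A *\<^sub>v x) \<bullet> (P *\<^sub>v y) + x \<bullet> (P *\<^sub>v (A *\<^sub>v y)) + (C *\<^sub>v x) \<bullet> (C *\<^sub>v y)
      = (B\<^sup>T *\<^sub>v (P *\<^sub>v x)) \<bullet> (B\<^sup>T *\<^sub>v (P *\<^sub>v y)))"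
    (is "_ \<longleftrightarrow> ?weak")
proof -
  define E where "E = A\<^sup>T * P + P * A - P * B * B\<^sup>T * P + C\<^sup>T * C"
  have c: "A\<^sup>T * P \<in> carrier_mat N N" "P * A \<in> carrier_mat N N" "P * B \<in> carrier_mat N p"
    "P * B * B\<^sup>T \<in> carrier_mat N N" "P * B * B\<^sup>T * P \<in> carrier_mat N N" "C\<^sup>T * C \<in> carrier_mat N N"
    "A\<^sup>T * P + P * A \<in> carrier_mat N N" "A\<^sup>T * P + P * A - P * B * B\<^sup>T * P \<in> carrier_mat N N"
    using A B C P by auto
  have E: "E \<in> carrier_mat N N" unfolding E_def using c(6,8) by simp
  have form: "x \<bullet> (E *\<^sub>v y) = (A *\<^sub>v x) \<bullet> (P *\<^sub>v y) + x \<bullet> (P *\<^sub>v (A *\<^sub>v y))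
      - (B\<^sup>T *\<^sub>v (P *\<^sub>v x)) \<bullet> (B\<^sup>T *\<^sub>v (P *\<^sub>v y)) + (C *\<^sub>v x) \<bullet> (C *\<^sub>v y)"
    if x: "x \<in> carrier_vec N" and y: "y \<in> carrier_vec N" for x y
  proof -
    define g where "g = P *\<^sub>v y"
    define h where "h = B\<^sup>T *\<^sub>v g"
    define k where "k = C *\<^sub>v y"
    have v: "g \<in> carrier_vec N" "h \<in> carrier_vec p" "k \<in> carrier_vec q" "A *\<^sub>v y \<in> carrier_vec N"
      "A\<^sup>T *\<^sub>v g \<in> carrier_vec N" "P *\<^sub>v (A *\<^sub>v y) \<in> carrier_vec N" "B *\<^sub>v h \<in> carrier_vec N"
      "P *\<^sub>v (B *\<^sub>v h) \<in> carrier_vec N" "C\<^sup>T *\<^sub>v k \<in> carrier_vec N"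
      using A B C P y unfolding g_def h_def k_def by auto
    have Ey: "E *\<^sub>v y = A\<^sup>T *\<^sub>v g + P *\<^sub>v (A *\<^sub>v y) - P *\<^sub>v (B *\<^sub>v h) + C\<^sup>T *\<^sub>v k"
      unfolding E_def using c y A B C P v
      by (simp add: add_mult_distrib_mat_vec[of _ N N] minus_mult_distrib_mat_vec[of _ N N]
          assoc_mult_mat_vec[of _ N N _ N] assoc_mult_mat_vec[of _ N p _ N]
          assoc_mult_mat_vec[of _ N N _ p] assoc_mult_mat_vec[of _ N q _ N] g_def h_def k_def)
    have T: "x \<bullet> (A\<^sup>T *\<^sub>v g) = (A *\<^sub>v x) \<bullet> g" "x \<bullet> (C\<^sup>T *\<^sub>v k) = (C *\<^sub>v x) \<bullet> k"
      "x \<bullet> (P *\<^sub>v (B *\<^sub>v h)) = (B\<^sup>T *\<^sub>v (P *\<^sub>v x)) \<bullet> h"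
    proof -
      show "x \<bullet> (A\<^sup>T *\<^sub>v g) = (A *\<^sub>v x) \<bullet> g"
        using transpose_vec_mult_scalar[of "A\<^sup>T" N N g x] A v x by simp
      show "x \<bullet> (C\<^sup>T *\<^sub>v k) = (C *\<^sub>v x) \<bullet> k"
        using transpose_vec_mult_scalar[of "C\<^sup>T" N q k x] C v x by simp
      have "x \<bullet> (P *\<^sub>v (B *\<^sub>v h)) = (B *\<^sub>v h) \<bullet> (P *\<^sub>v x)"
        using psd_symmetric[OF P(2,1) x] v by simp
      also have "\<dots> = (P *\<^sub>v x) \<bullet> (B *\<^sub>v h)"
        by (rule comm_scalar_prod) (use v P x in auto)
      also have "\<dots> = (B\<^sup>T *\<^sub>v (P *\<^sub>v x)) \<bullet> h"
        using transpose_vec_mult_scalar[of B N p h "P *\<^sub>v x"] B v P x by simp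
      finally show "x \<bullet> (P *\<^sub>v (B *\<^sub>v h)) = (B\<^sup>T *\<^sub>v (P *\<^sub>v x)) \<bullet> h" .
    qed
    show ?thesis unfolding Ey using x v T
      by (simp add: scalar_prod_add_distrib[of _ N] scalar_prod_minus_distrib[of _ N]
          g_def[symmetric] h_def[symmetric] k_def[symmetric])
  qed
  have "E = 0\<^sub>m N N \<longleftrightarrow> (\<forall>x\<in>carrier_vec N. \<forall>y\<in>carrier_vec N. x \<bullet> (E *\<^sub>v y) = 0)"
  proof
    assume "E = 0\<^sub>m N N"
    then have "E *\<^sub>v y = 0\<^sub>v N" if "y \<in> carrier_vec N" for y
      using that by (intro eq_vecI) auto
    then show "\<forall>x\<in>carrier_vec N. \<forall>y\<in>carrier_vec N. x \<bullet> (E *\<^sub>v y) = 0" by simp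
  next
    assume *: "\<forall>x\<in>carrier_vec N. \<forall>y\<in>carrier_vec N. x \<bullet> (E *\<^sub>v y) = 0"
    show "E = 0\<^sub>m N N"
    proof (rule eq_matI)
      fix i j assume "i < dim_row (0\<^sub>m N N :: real mat)" "j < dim_col (0\<^sub>m N N :: real mat)"
      then have ij: "i < N" "j < N" by auto
      have "unit_vec N i \<bullet> (E *\<^sub>v unit_vec N j) = E $$ (i, j)"
        using E ij by (simp add: scalar_prod_left_unit[of _ N])
      with * show "E $$ (i, j) = 0\<^sub>m N N $$ (i, j)" using ij by simp
    qed (use E in auto)
  qed
  moreover have "psd_are_solution A B (C\<^sup>T * C) P \<longleftrightarrow> E = 0\<^sub>m N N"
    using A P unfolding psd_are_solution_def E_def by simp
  ultimately show ?thesis by (simp add: form algebra_simps)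
qed

text \<open>An equilibrium \<open>y\<close> of the uncontrolled system without output costs nothing, so the smallest solution
must vanish there. Otherwise, with \<open>g = P *\<^sub>v y\<close> and \<open>s = y \<bullet> g > 0\<close>, the rank-one correction
\<open>P - g g\<^sup>T / s\<close>, whose form at \<open>x\<close> is the minimum of the form of \<open>P\<close> over all \<open>x - c \<cdot>\<^sub>v y\<close>,
would be a smaller solution: the Riccati equation at \<open>y\<close> gives \<open>B\<^sup>T *\<^sub>v g = 0\<close> and \<open>A\<^sup>T *\<^sub>v g = 0\<close>,
so that the correction drops out of every term.\<close>

lemma smallest_are_solution_annihilates:
  assumes A: "A \<in> carrier_mat N N" and B: "B \<in> carrier_mat N p" and C: "C \<in> carrier_mat q N"
    and P: "smallest_psd_are_solution A B (C\<^sup>T * C) P"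
    and y: "y \<in> carrier_vec N" "A *\<^sub>v y = 0\<^sub>v N" "C *\<^sub>v y = 0\<^sub>v q"
  shows "P *\<^sub>v y = 0\<^sub>v N"
proof (rule ccontr)
  assume contra: "P *\<^sub>v y \<noteq> 0\<^sub>v N"
  have sol: "psd_are_solution A B (C\<^sup>T * C) P"
    and least: "\<And>P0. psd_are_solution A B (C\<^sup>T * C) P0 \<Longrightarrow> psd (P0 - P)"
    using P unfolding smallest_psd_are_solution_def by auto
  have PN: "P \<in> carrier_mat N N" and psdP: "psd P"
    using sol A unfolding psd_are_solution_def by auto
  define g where "g = P *\<^sub>v y"
  define s where "s = y \<bullet> g"
  have g: "g \<in> carrier_vec N" unfolding g_def using PN y by simp
  have "s \<ge> 0" unfolding s_def g_def by (rule psd_nonneg[OF psdP PN y(1)])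
  moreover have "s \<noteq> 0" using psd_zero_form[OF psdP PN y(1)] contra unfolding s_def g_def by blast
  ultimately have s: "s > 0" by simp
  have weak: "(A *\<^sub>v x) \<bullet> (P *\<^sub>v z) + x \<bullet> (P *\<^sub>v (A *\<^sub>v z)) + (C *\<^sub>v x) \<bullet> (C *\<^sub>v z)
      = (B\<^sup>T *\<^sub>v (P *\<^sub>v x)) \<bullet> (B\<^sup>T *\<^sub>v (P *\<^sub>v z))"
    if "x \<in> carrier_vec N" "z \<in> carrier_vec N" for x z
    using sol that unfolding are_solution_weak_form[OF A B C PN psdP] by blast
  have P0v: "P *\<^sub>v 0\<^sub>v N = 0\<^sub>v N" using PN by (intro eq_vecI) auto
  have Bg: "B\<^sup>T *\<^sub>v g = 0\<^sub>v p"
  proof -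
    have "(B\<^sup>T *\<^sub>v g) \<bullet> (B\<^sup>T *\<^sub>v g) = 0"
      using weak[OF y(1) y(1)] y g PN by (simp add: g_def[symmetric] P0v)
    from scalar_prod_self_eq_0[OF this] show ?thesis using B by simp
  qed
  have Ag: "(A *\<^sub>v x) \<bullet> g = 0" if x: "x \<in> carrier_vec N" for x
  proof -
    have "B\<^sup>T *\<^sub>v (P *\<^sub>v x) \<in> carrier_vec p" "C *\<^sub>v x \<in> carrier_vec q" using B C PN x by auto
    then show ?thesis using weak[OF x y(1)] x y PN Bg by (simp add: P0v g_def[symmetric])
  qed

  define P0 where "P0 = mat N N (\<lambda>(i, j). P $$ (i, j) - g $ i * g $ j / s)"
  have P0N: "P0 \<in> carrier_mat N N" unfolding P0_def by simp
  have P0x: "P0 *\<^sub>v x = P *\<^sub>v x - (g \<bullet> x / s) \<cdot>\<^sub>v g" if x: "x \<in> carrier_vec N" for x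
  proof (rule eq_vecI)
    fix i assume "i < dim_vec (P *\<^sub>v x - (g \<bullet> x / s) \<cdot>\<^sub>v g)"
    then have i: "i < N" using g by simp
    have "(P0 *\<^sub>v x) $ i = (\<Sum>j\<in>{0..<N}. P $$ (i, j) * x $ j - g $ j * x $ j * (g $ i / s))"
      using i x by (simp add: P0_def scalar_prod_def algebra_simps)
    also have "\<dots> = (P *\<^sub>v x) $ i - (g \<bullet> x) * (g $ i / s)"
      using i x PN by (simp add: sum_subtractf scalar_prod_def sum_distrib_right sum_divide_distrib)
    finally show "(P0 *\<^sub>v x) $ i = (P *\<^sub>v x - (g \<bullet> x / s) \<cdot>\<^sub>v g) $ i"
      using i g PN by simp
  qed (use g P0N in simp)
  have P0form: "x \<bullet> (P0 *\<^sub>v z) = x \<bullet> (P *\<^sub>v z) - (g \<bullet> z) * (x \<bullet> g) / s"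
    if "x \<in> carrier_vec N" "z \<in> carrier_vec N" for x z
    using that g PN by (simp add: P0x scalar_prod_minus_distrib[of _ N])
  have comm: "g \<bullet> x = x \<bullet> g" if "x \<in> carrier_vec N" for x
    by (rule comm_scalar_prod[OF g that])
  have "psd P0"
    unfolding psd_def
  proof (intro conjI ballI)
    show "P0\<^sup>T = P0"
    proof (rule eq_matI)
      fix i j assume "i < dim_row P0" "j < dim_col P0"
      then have ij: "i < N" "j < N" by (auto simp: P0_def)
      have "P\<^sup>T = P" using psdP unfolding psd_def by blast
      then have "P $$ (j, i) = P $$ (i, j)" using ij PN by (metis carrier_matD index_transpose_mat(1))
      then show "P0\<^sup>T $$ (i, j) = P0 $$ (i, j)" using ij by (simp add: P0_def)
    qed (auto simp: P0_def)
    fix x :: "real vec" assume "x \<in> carrier_vec (dim_row P0)"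
    then have x: "x \<in> carrier_vec N" using P0N by simp
    \<comment> \<open>the minimizer of the form of \<open>P\<close> over \<open>x - c \<cdot>\<^sub>v y\<close>\<close>
    define c where "c = (x \<bullet> g) / s"
    have "y \<bullet> (P *\<^sub>v x) = x \<bullet> g"
      unfolding g_def by (rule psd_symmetric[OF psdP PN y(1) x])
    have "0 \<le> (x - c \<cdot>\<^sub>v y) \<bullet> (P *\<^sub>v (x - c \<cdot>\<^sub>v y))"
      using x y by (intro psd_nonneg[OF psdP PN]) auto
    also have "P *\<^sub>v (x - c \<cdot>\<^sub>v y) = P *\<^sub>v x - c \<cdot>\<^sub>v g"
      using PN x y by (simp add: mult_minus_distrib_mat_vec[of P N N] mult_mat_vec[of P N N] g_def)
    also have "(x - c \<cdot>\<^sub>v y) \<bullet> (P *\<^sub>v x - c \<cdot>\<^sub>v g) = x \<bullet> (P *\<^sub>v x) - c * (x \<bullet> g) - c * (x \<bullet> g - c * s)"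
      using x y g PN \<open>y \<bullet> (P *\<^sub>v x) = x \<bullet> g\<close>
      by (simp add: minus_scalar_prod_distrib[of _ N] scalar_prod_minus_distrib[of _ N]
          s_def algebra_simps)
    also have "c * s = x \<bullet> g" using s by (simp add: c_def)
    finally show "0 \<le> x \<bullet> (P0 *\<^sub>v x)"
      unfolding P0form[OF x x] comm[OF x] by (simp add: c_def)
  qed (use P0N in simp)
  have "psd_are_solution A B (C\<^sup>T * C) P0"
    unfolding are_solution_weak_form[OF A B C P0N \<open>psd P0\<close>]
  proof (intro ballI)
    fix x z :: "real vec" assume x: "x \<in> carrier_vec N" and z: "z \<in> carrier_vec N"
    have Ax: "A *\<^sub>v x \<in> carrier_vec N" "A *\<^sub>v z \<in> carrier_vec N" using A x z by auto
    have "B\<^sup>T *\<^sub>v (P0 *\<^sub>v u) = B\<^sup>T *\<^sub>v (P *\<^sub>v u)" if u: "u \<in> carrier_vec N" for u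
      using u B PN g Bg
      by (simp add: P0x mult_minus_distrib_mat_vec[of "B\<^sup>T" p N] mult_mat_vec[of "B\<^sup>T" p N],
          intro eq_vecI) auto
    with weak[OF x z] x z Ax
    show "(A *\<^sub>v x) \<bullet> (P0 *\<^sub>v z) + x \<bullet> (P0 *\<^sub>v (A *\<^sub>v z)) + (C *\<^sub>v x) \<bullet> (C *\<^sub>v z)
      = (B\<^sup>T *\<^sub>v (P0 *\<^sub>v x)) \<bullet> (B\<^sup>T *\<^sub>v (P0 *\<^sub>v z))"
      by (simp add: P0form Ag comm)
  qed
  from least[OF this] have "psd (P0 - P)" .
  then have "0 \<le> y \<bullet> ((P0 - P) *\<^sub>v y)"
    by (rule psd_nonneg[OF _ minus_carrier_mat[OF PN] y(1)])
  also have "\<dots> = y \<bullet> (P0 *\<^sub>v y) - y \<bullet> (P *\<^sub>v y)"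
    using P0N PN y(1) by (simp add: minus_mult_distrib_mat_vec[of _ N N] scalar_prod_minus_distrib[of _ N])
  also have "\<dots> = - s"
    using s unfolding P0form[OF y(1) y(1)] comm[OF y(1)] s_def[symmetric] by simp
  finally show False using s by simp
qed

text \<open>The derivative of \<open>z \<bullet> (P *\<^sub>v z)\<close> along the closed loop is minus the running cost: on the diagonal, the
Riccati equation says this for the uncontrolled system with the control term of opposite sign,
and the feedback contributes that term twice.\<close>

lemma closed_loop_energy:
  assumes A: "A \<in> carrier_mat N N" and B: "B \<in> carrier_mat N p" and C: "C \<in> carrier_mat q N"
    and P: "psd_are_solution A B (C\<^sup>T * C) P"
    and z: "z \<in> carrier_vec N"
  shows "2 * (z \<bullet> (P *\<^sub>v ((A - B * (B\<^sup>T * P)) *\<^sub>v z))) =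
    - ((C *\<^sub>v z) \<bullet> (C *\<^sub>v z)) - (B\<^sup>T *\<^sub>v (P *\<^sub>v z)) \<bullet> (B\<^sup>T *\<^sub>v (P *\<^sub>v z))"
proof -
  have PN: "P \<in> carrier_mat N N" and psdP: "psd P"
    using P A unfolding psd_are_solution_def by auto
  define h where "h = B\<^sup>T *\<^sub>v (P *\<^sub>v z)"
  have v: "h \<in> carrier_vec p" "A *\<^sub>v z \<in> carrier_vec N" "B *\<^sub>v h \<in> carrier_vec N"
      "P *\<^sub>v z \<in> carrier_vec N" "P *\<^sub>v (B *\<^sub>v h) \<in> carrier_vec N" "P *\<^sub>v (A *\<^sub>v z) \<in> carrier_vec N"
    using A B PN z unfolding h_def by auto
  have "B\<^sup>T * P \<in> carrier_mat p N" "B * (B\<^sup>T * P) \<in> carrier_mat N N" using B PN by auto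
  then have "(A - B * (B\<^sup>T * P)) *\<^sub>v z = A *\<^sub>v z - B *\<^sub>v h"
    using A B PN z by (simp add: minus_mult_distrib_mat_vec[of _ N N]
        assoc_mult_mat_vec[of _ N p _ N] assoc_mult_mat_vec[of _ p N _ N] h_def)
  then have "z \<bullet> (P *\<^sub>v ((A - B * (B\<^sup>T * P)) *\<^sub>v z)) = z \<bullet> (P *\<^sub>v (A *\<^sub>v z)) - z \<bullet> (P *\<^sub>v (B *\<^sub>v h))"
    using v z PN by (simp add: mult_minus_distrib_mat_vec[of P N N] scalar_prod_minus_distrib[of _ N])
  moreover have "z \<bullet> (P *\<^sub>v (B *\<^sub>v h)) = h \<bullet> h"
  proof -
    have "z \<bullet> (P *\<^sub>v (B *\<^sub>v h)) = (B *\<^sub>v h) \<bullet> (P *\<^sub>v z)"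
      by (rule psd_symmetric[OF psdP PN z v(3)])
    also have "\<dots> = (P *\<^sub>v z) \<bullet> (B *\<^sub>v h)" by (rule comm_scalar_prod[OF v(3,4)])
    also have "\<dots> = h \<bullet> h"
      using transpose_vec_mult_scalar[OF B v(1,4)] by (simp add: h_def)
    finally show ?thesis .
  qed
  moreover have "(A *\<^sub>v z) \<bullet> (P *\<^sub>v z) = z \<bullet> (P *\<^sub>v (A *\<^sub>v z))"
    using psd_symmetric[OF psdP PN v(2) z] .
  moreover have "(A *\<^sub>v z) \<bullet> (P *\<^sub>v z) + z \<bullet> (P *\<^sub>v (A *\<^sub>v z)) + (C *\<^sub>v z) \<bullet> (C *\<^sub>v z) = h \<bullet> h"
    using P z unfolding are_solution_weak_form[OF A B C PN psdP] h_def by blast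
  ultimately show ?thesis unfolding h_def[symmetric] by simp
qed

text \<open>Both terms of the dissipation are squared norms. So where \<open>z \<bullet> (P *\<^sub>v z)\<close> does not decrease,
the feedback vanishes along with the output, and the closed loop moves like the uncontrolled system.\<close>

lemma closed_loop_no_dissipation:
  assumes A: "A \<in> carrier_mat N N" and B: "B \<in> carrier_mat N p" and C: "C \<in> carrier_mat q N"
    and P: "psd_are_solution A B (C\<^sup>T * C) P"
    and z: "z \<in> carrier_vec N"
    and nonneg: "0 \<le> z \<bullet> (P *\<^sub>v ((A - B * (B\<^sup>T * P)) *\<^sub>v z))"
  shows "C *\<^sub>v z = 0\<^sub>v q" and "(A - B * (B\<^sup>T * P)) *\<^sub>v z = A *\<^sub>v z"
proof -
  have PN: "P \<in> carrier_mat N N"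
    using P A unfolding psd_are_solution_def by auto
  define h where "h = B\<^sup>T *\<^sub>v (P *\<^sub>v z)"
  have "(C *\<^sub>v z) \<bullet> (C *\<^sub>v z) + h \<bullet> h \<le> 0"
    using closed_loop_energy[OF A B C P z] nonneg unfolding h_def by linarith
  then have "(C *\<^sub>v z) \<bullet> (C *\<^sub>v z) = 0" "h \<bullet> h = 0"
    using scalar_prod_self_nonneg[of "C *\<^sub>v z"] scalar_prod_self_nonneg[of h] by linarith+
  then have "C *\<^sub>v z = 0\<^sub>v q" "h = 0\<^sub>v p"
    using scalar_prod_self_eq_0[of "C *\<^sub>v z"] scalar_prod_self_eq_0[of h] B C by (auto simp: h_def)
  then show "C *\<^sub>v z = 0\<^sub>v q" by simp
  have "B *\<^sub>v h = 0\<^sub>v N" using \<open>h = 0\<^sub>v p\<close> B by (intro eq_vecI) auto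
  moreover have "B\<^sup>T * P \<in> carrier_mat p N" "B * (B\<^sup>T * P) \<in> carrier_mat N N" using B PN by auto
  then have "(A - B * (B\<^sup>T * P)) *\<^sub>v z = A *\<^sub>v z - B *\<^sub>v h"
    using A B PN z by (simp add: minus_mult_distrib_mat_vec[of _ N N]
        assoc_mult_mat_vec[of _ N p _ N] assoc_mult_mat_vec[of _ p N _ N] h_def)
  moreover have "A *\<^sub>v z - 0\<^sub>v N = A *\<^sub>v z" using A z by (intro minus_zero_vec) simp
  ultimately show "(A - B * (B\<^sup>T * P)) *\<^sub>v z = A *\<^sub>v z" by simp
qed

text \<open>For an eigenvector \<open>a + i b\<close> the cost rates at \<open>a\<close> and \<open>b\<close> add up to \<open>Re \<mu>\<close> times the costs, as the
mixed terms cancel by symmetry of \<open>P\<close>. If \<open>Re \<mu> \<ge> 0\<close> this sum is nonnegative, while neither rate is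
positive; so neither dissipates and the mode is an output-free mode of the uncontrolled system.
The conclusion is stated on real and imaginary parts because the system matrices are real.\<close>

lemma closed_loop_unstable_mode:
  assumes A: "A \<in> carrier_mat N N" and B: "B \<in> carrier_mat N p" and C: "C \<in> carrier_mat q N"
    and P: "psd_are_solution A B (C\<^sup>T * C) P"
    and v: "eigenvector (complexify (A - B * (B\<^sup>T * P))) v \<mu>" "0 \<le> Re \<mu>"
  shows "C *\<^sub>v map_vec Re v = 0\<^sub>v q" "C *\<^sub>v map_vec Im v = 0\<^sub>v q"
    and "A *\<^sub>v map_vec Re v = Re \<mu> \<cdot>\<^sub>v map_vec Re v - Im \<mu> \<cdot>\<^sub>v map_vec Im v"
    and "A *\<^sub>v map_vec Im v = Im \<mu> \<cdot>\<^sub>v map_vec Re v + Re \<mu> \<cdot>\<^sub>v map_vec Im v"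
proof -
  let ?M = "A - B * (B\<^sup>T * P)"
  have PN: "P \<in> carrier_mat N N" and psdP: "psd P"
    using P A unfolding psd_are_solution_def by auto
  have M: "?M \<in> carrier_mat N N" using A B PN by auto
  have vN: "v \<in> carrier_vec N" and ev: "complexify ?M *\<^sub>v v = \<mu> \<cdot>\<^sub>v v"
    using v(1) M unfolding eigenvector_def by auto
  define a b where "a = map_vec Re v" and "b = map_vec Im v"
  have ab: "a \<in> carrier_vec N" "b \<in> carrier_vec N" unfolding a_def b_def using vN by auto
  have Ma: "?M *\<^sub>v a = Re \<mu> \<cdot>\<^sub>v a - Im \<mu> \<cdot>\<^sub>v b"
    unfolding a_def b_def Re_complexify_mult(1)[OF M vN, symmetric] ev using vN by (intro eq_vecI) auto
  have Mb: "?M *\<^sub>v b = Im \<mu> \<cdot>\<^sub>v a + Re \<mu> \<cdot>\<^sub>v b"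
    unfolding a_def b_def Re_complexify_mult(2)[OF M vN, symmetric] ev using vN by (intro eq_vecI) auto
  have Pab: "P *\<^sub>v a \<in> carrier_vec N" "P *\<^sub>v b \<in> carrier_vec N" using ab PN by auto
  have sym: "b \<bullet> (P *\<^sub>v a) = a \<bullet> (P *\<^sub>v b)" by (rule psd_symmetric[OF psdP PN ab(2,1)])
  have "a \<bullet> (P *\<^sub>v (?M *\<^sub>v a)) = Re \<mu> * (a \<bullet> (P *\<^sub>v a)) - Im \<mu> * (a \<bullet> (P *\<^sub>v b))"
    unfolding Ma using ab Pab PN
    by (simp add: mult_minus_distrib_mat_vec[of P N N] mult_mat_vec[of P N N]
        scalar_prod_minus_distrib[of _ N])
  moreover have "b \<bullet> (P *\<^sub>v (?M *\<^sub>v b)) = Im \<mu> * (a \<bullet> (P *\<^sub>v b)) + Re \<mu> * (b \<bullet> (P *\<^sub>v b))"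
    unfolding Mb using ab Pab PN sym
    by (simp add: mult_add_distrib_mat_vec[of P N N] mult_mat_vec[of P N N]
        scalar_prod_add_distrib[of _ N])
  ultimately have "a \<bullet> (P *\<^sub>v (?M *\<^sub>v a)) + b \<bullet> (P *\<^sub>v (?M *\<^sub>v b)) =
      Re \<mu> * (a \<bullet> (P *\<^sub>v a)) + Re \<mu> * (b \<bullet> (P *\<^sub>v b))" by simp
  moreover have "0 \<le> Re \<mu> * (a \<bullet> (P *\<^sub>v a)) + Re \<mu> * (b \<bullet> (P *\<^sub>v b))"
    using v(2) psd_nonneg[OF psdP PN] ab by simp
  moreover have "z \<bullet> (P *\<^sub>v (?M *\<^sub>v z)) \<le> 0" if "z \<in> carrier_vec N" for z
    using closed_loop_energy[OF A B C P that] scalar_prod_self_nonneg[of "C *\<^sub>v z"]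
      scalar_prod_self_nonneg[of "B\<^sup>T *\<^sub>v (P *\<^sub>v z)"] by linarith
  ultimately have "0 \<le> a \<bullet> (P *\<^sub>v (?M *\<^sub>v a))" "0 \<le> b \<bullet> (P *\<^sub>v (?M *\<^sub>v b))"
    using ab by (smt (verit))+
  note za = closed_loop_no_dissipation[OF A B C P ab(1) this(1)]
    and zb = closed_loop_no_dissipation[OF A B C P ab(2) this(2)]
  show "C *\<^sub>v map_vec Re v = 0\<^sub>v q" "C *\<^sub>v map_vec Im v = 0\<^sub>v q"
    and "A *\<^sub>v map_vec Re v = Re \<mu> \<cdot>\<^sub>v map_vec Re v - Im \<mu> \<cdot>\<^sub>v map_vec Im v"
    and "A *\<^sub>v map_vec Im v = Im \<mu> \<cdot>\<^sub>v map_vec Re v + Re \<mu> \<cdot>\<^sub>v map_vec Im v"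
    using za zb Ma Mb unfolding a_def b_def by simp_all
qed

section \<open>Blocks of the control problem\<close>

lemma vcat_blocks:
  assumes "list_all2 (\<lambda>r M. M \<in> carrier_mat r m) rs Ms"
  shows "vcat m Ms \<in> carrier_mat (sum_list rs) m \<and>
    (\<forall>u\<in>carrier_vec m. \<forall>j<length rs. \<forall>i<rs ! j.
      (vcat m Ms *\<^sub>v u) $ (sum_list (take j rs) + i) = (Ms ! j *\<^sub>v u) $ i)"
  using assms
proof (induction rs Ms rule: list_all2_induct)
  case Nil
  then show ?case by (simp add: vcat_def)
next
  case (Cons r rs M Ms)
  have eq: "vcat m (M # Ms) = M @\<^sub>r vcat m Ms" by (simp add: vcat_def)
  have c: "vcat m Ms \<in> carrier_mat (sum_list rs) m" using Cons by blast
  have "(vcat m (M # Ms) *\<^sub>v u) $ (sum_list (take j (r # rs)) + i) = ((M # Ms) ! j *\<^sub>v u) $ i"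
    if u: "u \<in> carrier_vec m" and j: "j < length (r # rs)" and i: "i < (r # rs) ! j" for u j i
  proof (cases j)
    case 0
    then show ?thesis
      unfolding eq mat_mult_append[OF Cons.hyps(1) c u] using i Cons.hyps(1) by simp
  next
    case (Suc j')
    have IH: "(vcat m Ms *\<^sub>v u) $ (sum_list (take j' rs) + i) = (Ms ! j' *\<^sub>v u) $ i"
      using Cons.IH u i j Suc by simp
    have "sum_list (take j' rs) + i < sum_list rs"
    proof -
      have "sum_list rs = sum_list (take j' rs) + sum_list (drop j' rs)"
        by (metis append_take_drop_id sum_list_append)
      moreover have "drop j' rs = rs ! j' # drop (Suc j') rs"
        by (rule Cons_nth_drop_Suc[symmetric]) (use j Suc in simp)
      ultimately show ?thesis using i Suc by simp
    qed
    then show ?thesis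
      unfolding eq mat_mult_append[OF Cons.hyps(1) c u] using Cons.hyps(1) c IH Suc by simp
  qed
  moreover have "vcat m (M # Ms) \<in> carrier_mat (sum_list (r # rs)) m"
    unfolding eq using Cons.hyps(1) c by auto
  ultimately show ?case by blast
qed

lemma last_row_size_one:
  assumes "M \<in> carrier_mat 1 m"
  shows "last_row M = row M 0"
  using assms by (simp add: last_row_def rows_def)

lemma kernel_onb_mult:
  assumes H: "kernel_onb H M" and w: "w \<in> carrier_vec (dim_col H)"
  shows "M *\<^sub>v (H *\<^sub>v w) = 0\<^sub>v (dim_row M)"
proof -
  have "H *\<^sub>v w \<in> mat_range H" unfolding mat_range_def using w by blast
  then show ?thesis using H unfolding kernel_onb_def mat_kernel_def by simp
qed

text \<open>The choice of the output matrix: its kernel is the line through \<open>x\<close>. Subtracting from \<open>y\<close> its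
projection to that line leaves a vector that is both in the range of \<open>U\<close> and orthogonal to it.\<close>

lemma complement_of_kernel_onb:
  assumes x: "x \<in> carrier_vec n" "x \<noteq> 0\<^sub>v n"
    and U: "kernel_onb U (mat_of_row x)"
    and y: "y \<in> carrier_vec n" "U\<^sup>T *\<^sub>v y = 0\<^sub>v (dim_col U)"
  shows "\<exists>c. y = c \<cdot>\<^sub>v x"
proof -
  define c where "c = (x \<bullet> y) / (x \<bullet> x)"
  define r where "r = y - c \<cdot>\<^sub>v x"
  have r: "r \<in> carrier_vec n" unfolding r_def using x y by simp
  have "x \<bullet> x \<noteq> 0" using scalar_prod_self_eq_0[of x] x by auto
  then have xr: "x \<bullet> r = 0"
    unfolding r_def c_def using x y by (simp add: scalar_prod_minus_distrib[of _ n])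
  have "mat_of_row x *\<^sub>v r = 0\<^sub>v 1"
    using xr x by (intro eq_vecI) auto
  then have "r \<in> mat_kernel (mat_of_row x)"
    using r x by (intro mat_kernelI[of _ 1 n]) (auto simp: mat_of_row_def carrier_vecD)
  then have "r \<in> mat_range U" using U unfolding kernel_onb_def by simp
  then obtain a where a: "a \<in> carrier_vec (dim_col U)" "r = U *\<^sub>v a"
    unfolding mat_range_def by blast
  have Un: "U \<in> carrier_mat n (dim_col U)"
    using U carrier_vecD[OF x(1)] by (intro carrier_matI) (simp_all add: kernel_onb_def)
  have "r \<bullet> y = y \<bullet> (U *\<^sub>v a)" unfolding a(2)[symmetric] by (rule comm_scalar_prod[OF r y(1)])
  also have "\<dots> = (U\<^sup>T *\<^sub>v y) \<bullet> a" by (rule transpose_vec_mult_scalar[OF Un a(1) y(1), symmetric])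
  also have "\<dots> = 0" unfolding y(2) using a(1) by simp
  finally have "r \<bullet> y = 0" .
  moreover have "r \<bullet> x = 0" using xr comm_scalar_prod[OF r x(1)] by simp
  ultimately have "r \<bullet> (y - c \<cdot>\<^sub>v x) = 0"
    using r x y by (simp add: scalar_prod_minus_distrib[of _ n])
  then have "r \<bullet> r = 0" unfolding r_def[symmetric] .
  then have r0: "r = 0\<^sub>v n" using scalar_prod_self_eq_0[of r] carrier_vecD[OF r] by simp
  have "y = c \<cdot>\<^sub>v x"
  proof (rule eq_vecI)
    fix i assume "i < dim_vec (c \<cdot>\<^sub>v x)"
    then have i: "i < n" using x by simp
    have "r $ i = y $ i - c * x $ i" unfolding r_def using i x y by simp
    then show "y $ i = (c \<cdot>\<^sub>v x) $ i" using r0 i x by simp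
  qed (use x y in simp)
  then show ?thesis ..
qed

lemma A_bar_mult:
  assumes "A \<in> carrier_mat n n" "B \<in> carrier_mat n m" "H \<in> carrier_mat m k"
    and "F1 \<in> carrier_mat k n" "F2 \<in> carrier_mat k k"
    and "x \<in> carrier_vec n" "w \<in> carrier_vec k"
  shows "A_bar A B H F1 F2 *\<^sub>v (x @\<^sub>v w) =
    (A *\<^sub>v x + B *\<^sub>v (H *\<^sub>v w)) @\<^sub>v (F1 *\<^sub>v x + F2 *\<^sub>v w)"
proof -
  have "B * H \<in> carrier_mat n k" using assms by simp
  then show ?thesis
    unfolding A_bar_def using assms
    by (simp add: four_block_mat_mult_vec[of _ n n _ k _ k] assoc_mult_mat_vec[of _ n m _ k])
qed

lemma C_bar_mult:
  assumes "C \<in> carrier_mat q n" "x \<in> carrier_vec n" "w \<in> carrier_vec k"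
  shows "C_bar C k *\<^sub>v (x @\<^sub>v w) = C *\<^sub>v x"
proof -
  have "C_bar C k *\<^sub>v (x @\<^sub>v w) = (C *\<^sub>v x + 0\<^sub>m q k *\<^sub>v w) @\<^sub>v (0\<^sub>m 0 n *\<^sub>v x + 0\<^sub>m 0 k *\<^sub>v w)"
    unfolding C_bar_def hcat_def using assms
    by (simp add: four_block_mat_mult_vec[of _ q n _ k _ 0])
  also have "0\<^sub>m q k *\<^sub>v w = 0\<^sub>v q" using assms by (intro eq_vecI) auto
  also have "C *\<^sub>v x + 0\<^sub>v q = C *\<^sub>v x" using assms by simp
  also have "C *\<^sub>v x @\<^sub>v (0\<^sub>m 0 n *\<^sub>v x + 0\<^sub>m 0 k *\<^sub>v w) = C *\<^sub>v x"
    by (intro eq_vecI) auto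
  finally show ?thesis .
qed

lemma B_bar_mult:
  assumes "B \<in> carrier_mat n m" "K \<in> carrier_mat m m" "G \<in> carrier_mat k m" "v \<in> carrier_vec m"
  shows "B_bar B K G *\<^sub>v v = B *\<^sub>v (K *\<^sub>v v) @\<^sub>v G *\<^sub>v v"
proof -
  have "B * K \<in> carrier_mat n m" using assms by simp
  then show ?thesis
    unfolding B_bar_def using assms
    by (simp add: mat_mult_append[of _ n m _ k] assoc_mult_mat_vec[of _ n m _ m])
qed

lemma append_vec_splitE:
  assumes "z \<in> carrier_vec (n + k)"
  obtains x w where "x \<in> carrier_vec n" "w \<in> carrier_vec k" "z = x @\<^sub>v w"
  by (rule that[of "vec_first z n" "vec_last z k"]) (use assms in simp_all)

text \<open>The exclusion of \<open>V_mg_ge2\<close> in the form in which it is used: it yields a coordinate, at a block of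
size 1, where the formation vector can be told apart from every vector in the range of \<open>B * H\<close>.\<close>

lemma jordan_kernel_size_one_component:
  assumes x: "x \<in> carrier_vec n" "x \<noteq> 0\<^sub>v n" and A: "A \<in> carrier_mat n n" "A *\<^sub>v x = 0\<^sub>v n"
    and n: "n = r0 + sum_list rs" and V: "map_vec complex_of_real x \<notin> V_mg_ge2 A r0 rs"
  obtains j where "j < length rs" "rs ! j = 1" "r0 + sum_list (take j rs) < n"
    "x $ (r0 + sum_list (take j rs)) \<noteq> 0"
proof -
  let ?x = "map_vec complex_of_real x"
  have "A *\<^sub>v x = 0 \<cdot>\<^sub>v x" unfolding A(2) using x(1) by (intro eq_vecI) auto
  then have "eigenvector A x 0" unfolding eigenvector_def using A(1) x by simp
  from of_real_hom.eigenvector_hom[OF A(1) this]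
  have "eigenvector (complexify A) ?x 0" by simp
  with V obtain j where j: "j < length rs" "rs ! j = 1"
      "?x $ (r0 + sum_list (take j rs)) \<noteq> 0"
    unfolding V_mg_ge2_def by blast
  have "sum_list rs = sum_list (take j rs) + sum_list (drop j rs)"
    by (metis append_take_drop_id sum_list_append)
  moreover have "drop j rs = rs ! j # drop (Suc j) rs"
    by (rule Cons_nth_drop_Suc[symmetric, OF j(1)])
  ultimately have "r0 + sum_list (take j rs) < n" using j(2) n by simp
  with j x(1) show ?thesis by (intro that[of j]) auto
qed

text \<open>The exogenous input \<open>H *\<^sub>v w\<close> lies in the kernel of the last rows of the blocks, so it cannot act on
the last coordinate of a block, which for a block of size 1 is its only one.\<close>

lemma input_vanishes_at_size_one_block:
  assumes blocks: "list_all2 (\<lambda>r M. M \<in> carrier_mat r m) (r0 # rs) (B_r # Bs)"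
    and H: "H \<in> carrier_mat m k" "kernel_onb H (B_last m Bs)"
    and w: "w \<in> carrier_vec k" and j: "j < length rs" "rs ! j = 1"
  shows "(vcat m (B_r # Bs) *\<^sub>v (H *\<^sub>v w)) $ (r0 + sum_list (take j rs)) = 0"
proof -
  have zero_blocks: "list_all2 (\<lambda>r M. M \<in> carrier_mat r m) rs Bs" using blocks by simp
  have len: "length Bs = length rs" using list_all2_lengthD[OF zero_blocks] by simp
  have Bj: "Bs ! j \<in> carrier_mat 1 m" using list_all2_nthD[OF zero_blocks j(1)] j(2) by simp
  have Hw: "H *\<^sub>v w \<in> carrier_vec m" using H(1) w by simp
  have "(vcat m (B_r # Bs) *\<^sub>v (H *\<^sub>v w)) $ (sum_list (take (Suc j) (r0 # rs)) + 0) =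
      ((B_r # Bs) ! Suc j *\<^sub>v (H *\<^sub>v w)) $ 0"
    by (rule vcat_blocks[OF blocks, THEN conjunct2, rule_format]) (use Hw j in simp_all)
  also have "\<dots> = last_row (Bs ! j) \<bullet> (H *\<^sub>v w)"
    using last_row_size_one[OF Bj] Bj by simp
  also have "\<dots> = (B_last m Bs *\<^sub>v (H *\<^sub>v w)) $ j"
  proof -
    have "last_row (Bs ! j) \<in> carrier_vec m"
      unfolding last_row_size_one[OF Bj] by (rule row_carrier_vec[OF _ Bj]) simp
    then show ?thesis using j len by (simp add: B_last_def)
  qed
  also have "\<dots> = 0"
    using kernel_onb_mult[OF H(2), of w] H(1) w j len by (simp add: B_last_def)
  finally show ?thesis by simp
qed

lemma closed_loop_state_equation:
  assumes A: "A \<in> carrier_mat n n" and B: "B \<in> carrier_mat n m" and H: "H \<in> carrier_mat m k"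
    and F: "F1 \<in> carrier_mat k n" "F2 \<in> carrier_mat k k"
    and KG: "K \<in> carrier_mat m m" "G \<in> carrier_mat k m"
    and P: "P \<in> carrier_mat (n + k) (n + k)"
    and cl: "closed_loop A B H F1 F2 K G P x w"
  shows "has_deriv_on_nonneg (n + k) (\<lambda>t. x t @\<^sub>v w t)
    (\<lambda>t. (A_bar A B H F1 F2 - B_bar B K G * ((B_bar B K G)\<^sup>T * P)) *\<^sub>v (x t @\<^sub>v w t))"
proof -
  let ?N = "n + k"
  let ?A = "A_bar A B H F1 F2" and ?B = "B_bar B K G"
  let ?M = "?A - ?B * (?B\<^sup>T * P)"
  have Abar: "?A \<in> carrier_mat ?N ?N" unfolding A_bar_def using A F by simp
  have Bbar: "?B \<in> carrier_mat ?N m" unfolding B_bar_def using B KG by auto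
  obtain u v where
    x': "has_deriv_on_nonneg n x (\<lambda>t. A *\<^sub>v x t + B *\<^sub>v u t)" and
    w': "has_deriv_on_nonneg k w (\<lambda>t. F1 *\<^sub>v x t + F2 *\<^sub>v w t + G *\<^sub>v v t)" and
    u: "\<And>t. t \<ge> 0 \<Longrightarrow> u t = H *\<^sub>v w t + K *\<^sub>v v t" and
    v: "\<And>t. t \<ge> 0 \<Longrightarrow> v t = - (?B\<^sup>T * P *\<^sub>v (x t @\<^sub>v w t))"
    using cl A F unfolding closed_loop_def by auto
  have xt: "x t \<in> carrier_vec n" and wt: "w t \<in> carrier_vec k" if "0 \<le> t" for t
    using x' w' that unfolding has_deriv_on_nonneg_def by auto
  have field: "?M *\<^sub>v (x t @\<^sub>v w t) =
      (A *\<^sub>v x t + B *\<^sub>v u t) @\<^sub>v (F1 *\<^sub>v x t + F2 *\<^sub>v w t + G *\<^sub>v v t)" if t: "0 \<le> t" for t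
  proof -
    note xw = xt[OF t] wt[OF t]
    have z: "x t @\<^sub>v w t \<in> carrier_vec ?N" using xw by simp
    have L: "?B\<^sup>T * P \<in> carrier_mat m ?N" using Bbar P by simp
    have Lz: "?B\<^sup>T * P *\<^sub>v (x t @\<^sub>v w t) \<in> carrier_vec m" by (rule mult_mat_vec_carrier[OF L z])
    have vt: "v t \<in> carrier_vec m" unfolding v[OF t] using Lz by simp
    have "?M *\<^sub>v (x t @\<^sub>v w t) = ?A *\<^sub>v (x t @\<^sub>v w t) - ?B *\<^sub>v (?B\<^sup>T * P *\<^sub>v (x t @\<^sub>v w t))"
      using minus_mult_distrib_mat_vec[OF Abar mult_carrier_mat[OF Bbar L] z]
        assoc_mult_mat_vec[OF Bbar L z] by simp
    also have "\<dots> = ?A *\<^sub>v (x t @\<^sub>v w t) + ?B *\<^sub>v v t"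
    proof -
      have "?B *\<^sub>v v t = - (?B *\<^sub>v (?B\<^sup>T * P *\<^sub>v (x t @\<^sub>v w t)))"
        unfolding v[OF t] using Bbar Lz by (intro eq_vecI) auto
      then show ?thesis using Abar Bbar by (intro eq_vecI) auto
    qed
    also have "\<dots> = ((A *\<^sub>v x t + B *\<^sub>v (H *\<^sub>v w t)) @\<^sub>v (F1 *\<^sub>v x t + F2 *\<^sub>v w t)) + (B *\<^sub>v (K *\<^sub>v v t) @\<^sub>v G *\<^sub>v v t)"
      unfolding A_bar_mult[OF A B H F xw] B_bar_mult[OF B KG vt] ..
    also have "\<dots> = (A *\<^sub>v x t + (B *\<^sub>v (H *\<^sub>v w t) + B *\<^sub>v (K *\<^sub>v v t))) @\<^sub>v
        (F1 *\<^sub>v x t + F2 *\<^sub>v w t + G *\<^sub>v v t)"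
      using A B F KG xw vt by (intro eq_vecI) auto
    also have "B *\<^sub>v (H *\<^sub>v w t) + B *\<^sub>v (K *\<^sub>v v t) = B *\<^sub>v u t"
      unfolding u[OF t] using B H KG(1) xw vt by (simp add: mult_add_distrib_mat_vec[of B n m])
    finally show ?thesis .
  qed
  show "has_deriv_on_nonneg ?N (\<lambda>t. x t @\<^sub>v w t) (\<lambda>t. ?M *\<^sub>v (x t @\<^sub>v w t))"
    unfolding has_deriv_on_nonneg_def
  proof (intro allI impI conjI)
    fix t :: real assume t: "0 \<le> t"
    show "x t @\<^sub>v w t \<in> carrier_vec ?N" using xt[OF t] wt[OF t] by simp
    fix i assume i: "i < ?N"
    show "((\<lambda>s. (x s @\<^sub>v w s) $ i) has_real_derivative (?M *\<^sub>v (x t @\<^sub>v w t)) $ i) (at t within {0..})"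
    proof (cases "i < n")
      case True
      have "((\<lambda>s. x s $ i) has_real_derivative (A *\<^sub>v x t + B *\<^sub>v u t) $ i) (at t within {0..})"
        using x' t True unfolding has_deriv_on_nonneg_def by blast
      also have "(A *\<^sub>v x t + B *\<^sub>v u t) $ i = (?M *\<^sub>v (x t @\<^sub>v w t)) $ i"
        unfolding field[OF t] using True A B i by simp
      finally have D: "((\<lambda>s. x s $ i) has_real_derivative (?M *\<^sub>v (x t @\<^sub>v w t)) $ i) (at t within {0..})" .
      show ?thesis
        unfolding has_field_derivative_def
        by (rule has_derivative_transform[OF _ _ D[unfolded has_field_derivative_def]])
          (use t True i in \<open>auto simp: carrier_vecD[OF xt] carrier_vecD[OF wt]\<close>)
    next
      case False
      with i have ik: "i - n < k" by simp
      then have "((\<lambda>s. w s $ (i - n)) has_real_derivative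
          (F1 *\<^sub>v x t + F2 *\<^sub>v w t + G *\<^sub>v v t) $ (i - n)) (at t within {0..})"
        using w' t unfolding has_deriv_on_nonneg_def by blast
      also have "(F1 *\<^sub>v x t + F2 *\<^sub>v w t + G *\<^sub>v v t) $ (i - n) = (?M *\<^sub>v (x t @\<^sub>v w t)) $ i"
        unfolding field[OF t] using False A B F KG(2) i by simp
      finally have D: "((\<lambda>s. w s $ (i - n)) has_real_derivative (?M *\<^sub>v (x t @\<^sub>v w t)) $ i)
          (at t within {0..})" .
      show ?thesis
        unfolding has_field_derivative_def
        by (rule has_derivative_transform[OF _ _ D[unfolded has_field_derivative_def]])
          (use t False i in \<open>auto simp: carrier_vecD[OF xt] carrier_vecD[OF wt]\<close>)
    qed
  qed
qed

section \<open>Convergence to the formation line\<close>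

text \<open>The real form of \<open>\<mu> * (a + i b) = 0\<close> with \<open>\<mu> = s + i w\<close> nonzero.\<close>

lemma rotation_scaling_injective:
  fixes a b s w :: real
  assumes "s * a - w * b = 0" "w * a + s * b = 0" "s * s + w * w > 0"
  shows "a = 0" "b = 0"
proof -
  have "(s * s + w * w) * a = s * (s * a - w * b) + w * (w * a + s * b)"
    "(s * s + w * w) * b = s * (w * a + s * b) - w * (s * a - w * b)"
    by (simp_all add: algebra_simps)
  then show "a = 0" "b = 0" using assms by auto
qed

text \<open>The real form of \<open>(c1 + i c2) * y = \<mu> * (c1 + i c2) * x\<close> with \<open>\<mu> = s + i w\<close>: as \<open>x\<close> and \<open>y\<close> are real, only
the real part of \<open>\<mu>\<close> can relate them.\<close>

lemma rotation_scaling_real_part: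
  fixes c1 c2 s w x y :: real
  assumes "c1 * y = (s * c1 - w * c2) * x" "c2 * y = (w * c1 + s * c2) * x" "c1 * c1 + c2 * c2 > 0"
  shows "y = s * x"
proof -
  have "(c1 * c1 + c2 * c2) * y = c1 * (c1 * y) + c2 * (c2 * y)" by (simp add: algebra_simps)
  also have "\<dots> = (c1 * c1 + c2 * c2) * (s * x)" unfolding assms(1,2) by (simp add: algebra_simps)
  finally show ?thesis using assms(3) by auto
qed

theorem theorem3:
  fixes A B A_r B_r U_A H F1 F2 K G C P U_df :: "real mat"
    and Js Bs :: "real mat list" and rs :: "nat list"
    and x_df :: "real vec" and n m k r0 :: nat
  assumes A_r: "\<forall>J\<in>set Js. nonzero_jordan_block J" "A_r = diag_block_mat Js"
      "A_r \<in> carrier_mat r0 r0"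
    and A: "\<forall>r\<in>set rs. r \<ge> 1" "A = jordan_form Js rs" "A \<in> carrier_mat n n"
    and B: "B_r \<in> carrier_mat r0 m" "length Bs = length rs"
      "\<forall>j<length rs. Bs ! j \<in> carrier_mat (rs ! j) m"
      "B = vcat m (B_r # Bs)"
    and U_A: "kernel_onb U_A A"
    and H: "H \<in> carrier_mat m k" "kernel_onb H (B_last m Bs)"
    and x_df: "x_df \<in> carrier_vec n" "x_df \<noteq> 0\<^sub>v n"
      "x_df \<in> mat_range (X_tilde A_r B_r Bs H U_A)"
      "map_vec complex_of_real x_df \<notin> V_plus A \<union> V_mg_ge2 A r0 rs"
    and F: "F1 = 0\<^sub>m k n" "F2 = 0\<^sub>m k k"
    and KG: "K \<in> carrier_mat m m" "G \<in> carrier_mat k m"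
      "stabilizable (A_bar A B H F1 F2) (B_bar B K G)"
    and C: "U_df \<in> carrier_mat n (n - 1)" "kernel_onb U_df (mat_of_row x_df)" "C = U_df\<^sup>T"
    and P: "smallest_psd_are_solution (A_bar A B H F1 F2) (B_bar B K G)
      ((C_bar C k)\<^sup>T * C_bar C k) P"
  shows "drives_to_line A B H F1 F2 K G P x_df"
proof -
  let ?N = "n + k"
  let ?A = "A_bar A B H F1 F2" and ?B = "B_bar B K G" and ?C = "C_bar C k"
  let ?M = "?A - ?B * (?B\<^sup>T * P)"
  have n: "n = r0 + sum_list rs"
  proof -
    have "n = dim_row (jordan_form Js rs)" using A(2,3) by simp
    also have "\<dots> = dim_row A_r + sum_list rs"
      unfolding jordan_form_def dim_diag_block_mat A_r(2) by (simp add: o_def dim_diag_block_mat)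
    finally show ?thesis using A_r(3) by simp
  qed
  have blocks: "list_all2 (\<lambda>r M. M \<in> carrier_mat r m) (r0 # rs) (B_r # Bs)"
  proof -
    have "list_all2 (\<lambda>r M. M \<in> carrier_mat r m) rs Bs"
      using B(2,3) by (simp add: list_all2_conv_all_nth)
    then show ?thesis using B(1) by simp
  qed
  have BN: "B \<in> carrier_mat n m" using vcat_blocks[OF blocks] unfolding B(4) n by simp
  have CN: "C \<in> carrier_mat (n - 1) n" using C(1,3) by simp
  have F12: "F1 \<in> carrier_mat k n" "F2 \<in> carrier_mat k k" unfolding F by simp_all
  have Abar: "?A \<in> carrier_mat ?N ?N" unfolding A_bar_def F using A(3) by simp
  have Bbar: "?B \<in> carrier_mat ?N m" unfolding B_bar_def using BN KG by auto
  have Cbar: "?C \<in> carrier_mat (n - 1) ?N" unfolding C_bar_def hcat_def using CN by (intro carrier_matI) auto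
  have sol: "psd_are_solution ?A ?B (?C\<^sup>T * ?C) P"
    using P unfolding smallest_psd_are_solution_def by blast
  have PN: "P \<in> carrier_mat ?N ?N" using sol Abar unfolding psd_are_solution_def by simp
  have MN: "?M \<in> carrier_mat ?N ?N" using Abar Bbar PN by auto
  have zero_append: "0\<^sub>v ?N = (0\<^sub>v n :: real vec) @\<^sub>v 0\<^sub>v k" by (intro eq_vecI) auto
  note idle = closed_loop_no_dissipation[OF Abar Bbar Cbar sol]

  have A_mult: "?A *\<^sub>v (x @\<^sub>v w) = (A *\<^sub>v x + B *\<^sub>v (H *\<^sub>v w)) @\<^sub>v 0\<^sub>v k"
    if "x \<in> carrier_vec n" "w \<in> carrier_vec k" for x w
  proof -
    have "F1 *\<^sub>v x + F2 *\<^sub>v w = 0\<^sub>v k" unfolding F using that by (intro eq_vecI) auto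
    then show ?thesis using A_bar_mult[OF A(3) BN H(1) F12 that] by simp
  qed

  have on_line: "\<exists>c. x = c \<cdot>\<^sub>v x_df"
    if x: "x \<in> carrier_vec n" and w: "w \<in> carrier_vec k" and 0: "?C *\<^sub>v (x @\<^sub>v w) = 0\<^sub>v (n - 1)" for x w
    using complement_of_kernel_onb[OF x_df(1,2) C(2) x] 0 C(1)
    unfolding C_bar_mult[OF CN x w] unfolding C(3) by simp

  \<comment> \<open>the cost is stationary at an equilibrium of the closed loop, so there is no dissipation either\<close>
  have kernel_line: "?C *\<^sub>v z = 0\<^sub>v (n - 1)" "?A *\<^sub>v z = 0\<^sub>v ?N"
    if z: "z \<in> carrier_vec ?N" and 0: "?M *\<^sub>v z = 0\<^sub>v ?N" for z
  proof -
    have "P *\<^sub>v 0\<^sub>v ?N = 0\<^sub>v ?N" using PN by (intro eq_vecI) auto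
    then have "0 \<le> z \<bullet> (P *\<^sub>v (?M *\<^sub>v z))" unfolding 0 using z by simp
    from idle[OF z this] 0 show "?C *\<^sub>v z = 0\<^sub>v (n - 1)" "?A *\<^sub>v z = 0\<^sub>v ?N" by simp_all
  qed

  \<comment> \<open>A Jordan chain of length 2 at 0 would end in a multiple \<open>d \<cdot>\<^sub>v x_df\<close> of the formation vector.
    The chain does not dissipate since \<open>P\<close> kills its end, so its top lies on the line as well, and
    \<open>x_df\<close> would be a kernel vector of \<open>A\<close> of the form \<open>B *\<^sub>v (H *\<^sub>v w)\<close>, up to a factor. The latter
    has no component in blocks of size 1, which \<open>x_df \<notin> V_mg_ge2\<close> contradicts.\<close>
  have semisimple: "?M *\<^sub>v v = 0\<^sub>v ?N"
    if v: "v \<in> carrier_vec ?N" and MM: "?M *\<^sub>v (?M *\<^sub>v v) = 0\<^sub>v ?N" for v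
  proof -
    have u: "?M *\<^sub>v v \<in> carrier_vec ?N" using MN v by simp
    note Cu = kernel_line(1)[OF u MM] and Au = kernel_line(2)[OF u MM]
    have "P *\<^sub>v (?M *\<^sub>v v) = 0\<^sub>v ?N"
      by (rule smallest_are_solution_annihilates[OF Abar Bbar Cbar P u Au Cu])
    then have "0 \<le> v \<bullet> (P *\<^sub>v (?M *\<^sub>v v))" using v by simp
    note Cv = idle(1)[OF v this] and Mv = idle(2)[OF v this]
    obtain x w where xw: "x \<in> carrier_vec n" "w \<in> carrier_vec k" "v = x @\<^sub>v w"
      using append_vec_splitE[OF v] .
    obtain c where c: "x = c \<cdot>\<^sub>v x_df" using on_line xw Cv by blast
    have BHw: "B *\<^sub>v (H *\<^sub>v w) \<in> carrier_vec n" using BN H xw by simp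
    have uu: "?M *\<^sub>v v = (A *\<^sub>v x + B *\<^sub>v (H *\<^sub>v w)) @\<^sub>v 0\<^sub>v k"
      using Mv A_mult[OF xw(1,2)] unfolding xw(3) by (rule trans)
    have ux: "A *\<^sub>v x + B *\<^sub>v (H *\<^sub>v w) \<in> carrier_vec n" using A(3) xw(1) BHw by simp
    obtain d where d: "A *\<^sub>v x + B *\<^sub>v (H *\<^sub>v w) = d \<cdot>\<^sub>v x_df"
      using on_line[OF ux zero_carrier_vec] Cu unfolding uu by blast
    have "d = 0"
    proof (rule ccontr)
      assume "d \<noteq> 0"
      have "H *\<^sub>v 0\<^sub>v k = 0\<^sub>v m" "B *\<^sub>v 0\<^sub>v m = 0\<^sub>v n" using H(1) BN by (auto intro!: eq_vecI)
      then have "(A *\<^sub>v (d \<cdot>\<^sub>v x_df) + 0\<^sub>v n) @\<^sub>v 0\<^sub>v k = 0\<^sub>v n @\<^sub>v 0\<^sub>v k"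
        using Au A_mult[of "d \<cdot>\<^sub>v x_df" "0\<^sub>v k"] x_df(1) unfolding uu d zero_append by simp
      then have "A *\<^sub>v (d \<cdot>\<^sub>v x_df) + 0\<^sub>v n = 0\<^sub>v n"
        by (subst (asm) append_vec_eq[of _ n]) (use A(3) x_df(1) in auto)
      then have dA: "d \<cdot>\<^sub>v (A *\<^sub>v x_df) = 0\<^sub>v n" using A(3) x_df(1) by (simp add: mult_mat_vec[of A n n])
      have Ax: "A *\<^sub>v x_df = 0\<^sub>v n"
      proof (rule eq_vecI)
        fix i assume "i < dim_vec (0\<^sub>v n :: real vec)"
        then have i: "i < n" by simp
        have "(d \<cdot>\<^sub>v (A *\<^sub>v x_df)) $ i = 0" unfolding dA using i by simp
        then show "(A *\<^sub>v x_df) $ i = 0\<^sub>v n $ i" using i A(3) \<open>d \<noteq> 0\<close> by simp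
      qed (use A(3) in simp)
      obtain j where j: "j < length rs" "rs ! j = 1" "r0 + sum_list (take j rs) < n"
          "x_df $ (r0 + sum_list (take j rs)) \<noteq> 0"
        using jordan_kernel_size_one_component[OF x_df(1,2) A(3) Ax n] x_df(4) by blast
      have "A *\<^sub>v x = c \<cdot>\<^sub>v 0\<^sub>v n" unfolding c using A(3) x_df(1) Ax by (simp add: mult_mat_vec[of A n n])
      then have "(A *\<^sub>v x + B *\<^sub>v (H *\<^sub>v w)) $ (r0 + sum_list (take j rs)) = 0"
        using input_vanishes_at_size_one_block[OF blocks H xw(2) j(1,2), folded B(4)] j(3) BN by simp
      then show False unfolding d using j x_df(1) \<open>d \<noteq> 0\<close> by simp
    qed
    then show ?thesis unfolding uu d using x_df(1) by (intro eq_vecI) auto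
  qed

  \<comment> \<open>A mode for a nonzero \<open>\<mu>\<close> with \<open>Re \<mu> \<ge> 0\<close> is a mode of the uncontrolled system on the line. As the
    exogenous state does not move by itself, its exogenous part is 0, and \<open>x_df\<close> is an eigenvector
    of \<open>A\<close> for \<open>Re \<mu>\<close>. This is excluded by \<open>V_plus\<close> if \<open>Re \<mu> > 0\<close>, and forces \<open>\<mu> = 0\<close> if \<open>Re \<mu> = 0\<close>.\<close>
  have spectrum: "Re \<mu> < 0 \<or> \<mu> = 0" if ev: "eigenvalue (complexify ?M) \<mu>" for \<mu>
  proof (rule ccontr)
    assume "\<not> (Re \<mu> < 0 \<or> \<mu> = 0)"
    then have \<mu>: "0 \<le> Re \<mu>" "\<mu> \<noteq> 0" by auto
    obtain v where v: "eigenvector (complexify ?M) v \<mu>"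
      using ev unfolding eigenvalue_def by blast
    note mode = closed_loop_unstable_mode[OF Abar Bbar Cbar sol v \<mu>(1)]
    define \<sigma> \<omega> where "\<sigma> = Re \<mu>" and "\<omega> = Im \<mu>"
    have vN: "v \<in> carrier_vec ?N" and v0: "v \<noteq> 0\<^sub>v ?N"
      using v MN unfolding eigenvector_def by auto
    obtain xa wa where a: "xa \<in> carrier_vec n" "wa \<in> carrier_vec k" "map_vec Re v = xa @\<^sub>v wa"
      using append_vec_splitE[of "map_vec Re v" n k] vN by auto
    obtain xb wb where b: "xb \<in> carrier_vec n" "wb \<in> carrier_vec k" "map_vec Im v = xb @\<^sub>v wb"
      using append_vec_splitE[of "map_vec Im v" n k] vN by auto
    obtain c1 where c1: "xa = c1 \<cdot>\<^sub>v x_df" using on_line[OF a(1,2)] mode(1) a(3) by auto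
    obtain c2 where c2: "xb = c2 \<cdot>\<^sub>v x_df" using on_line[OF b(1,2)] mode(2) b(3) by auto
    have \<mu>pos: "\<sigma> * \<sigma> + \<omega> * \<omega> > 0"
      using \<mu>(2) by (simp add: \<sigma>_def \<omega>_def complex_neq_0 power2_eq_square)

    have ea: "(A *\<^sub>v xa + B *\<^sub>v (H *\<^sub>v wa)) @\<^sub>v 0\<^sub>v k = (\<sigma> \<cdot>\<^sub>v xa - \<omega> \<cdot>\<^sub>v xb) @\<^sub>v (\<sigma> \<cdot>\<^sub>v wa - \<omega> \<cdot>\<^sub>v wb)"
    proof -
      have "(A *\<^sub>v xa + B *\<^sub>v (H *\<^sub>v wa)) @\<^sub>v 0\<^sub>v k = \<sigma> \<cdot>\<^sub>v (xa @\<^sub>v wa) - \<omega> \<cdot>\<^sub>v (xb @\<^sub>v wb)"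
        using mode(3) unfolding a(3) b(3) A_mult[OF a(1,2)] \<sigma>_def \<omega>_def .
      also have "\<dots> = (\<sigma> \<cdot>\<^sub>v xa - \<omega> \<cdot>\<^sub>v xb) @\<^sub>v (\<sigma> \<cdot>\<^sub>v wa - \<omega> \<cdot>\<^sub>v wb)"
        using a(1,2) b(1,2) by (intro eq_vecI) auto
      finally show ?thesis .
    qed
    have eb: "(A *\<^sub>v xb + B *\<^sub>v (H *\<^sub>v wb)) @\<^sub>v 0\<^sub>v k = (\<omega> \<cdot>\<^sub>v xa + \<sigma> \<cdot>\<^sub>v xb) @\<^sub>v (\<omega> \<cdot>\<^sub>v wa + \<sigma> \<cdot>\<^sub>v wb)"
    proof -
      have "(A *\<^sub>v xb + B *\<^sub>v (H *\<^sub>v wb)) @\<^sub>v 0\<^sub>v k = \<omega> \<cdot>\<^sub>v (xa @\<^sub>v wa) + \<sigma> \<cdot>\<^sub>v (xb @\<^sub>v wb)"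
        using mode(4) unfolding a(3) b(3) A_mult[OF b(1,2)] \<sigma>_def \<omega>_def .
      also have "\<dots> = (\<omega> \<cdot>\<^sub>v xa + \<sigma> \<cdot>\<^sub>v xb) @\<^sub>v (\<omega> \<cdot>\<^sub>v wa + \<sigma> \<cdot>\<^sub>v wb)"
        using a(1,2) b(1,2) by (intro eq_vecI) auto
      finally show ?thesis .
    qed
    have top: "A *\<^sub>v xa + B *\<^sub>v (H *\<^sub>v wa) = \<sigma> \<cdot>\<^sub>v xa - \<omega> \<cdot>\<^sub>v xb"
        "A *\<^sub>v xb + B *\<^sub>v (H *\<^sub>v wb) = \<omega> \<cdot>\<^sub>v xa + \<sigma> \<cdot>\<^sub>v xb"
      and bottom: "\<sigma> \<cdot>\<^sub>v wa - \<omega> \<cdot>\<^sub>v wb = 0\<^sub>v k" "\<omega> \<cdot>\<^sub>v wa + \<sigma> \<cdot>\<^sub>v wb = 0\<^sub>v k"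
      using ea eb a(1,2) b(1,2) A(3) BN H(1)
        append_vec_eq[of "A *\<^sub>v xa + B *\<^sub>v (H *\<^sub>v wa)" n "\<sigma> \<cdot>\<^sub>v xa - \<omega> \<cdot>\<^sub>v xb"]
        append_vec_eq[of "A *\<^sub>v xb + B *\<^sub>v (H *\<^sub>v wb)" n "\<omega> \<cdot>\<^sub>v xa + \<sigma> \<cdot>\<^sub>v xb"]
      by auto
    have w0: "wa = 0\<^sub>v k" "wb = 0\<^sub>v k"
    proof -
      have "wa $ i = 0 \<and> wb $ i = 0" if i: "i < k" for i
      proof -
        have "(\<sigma> \<cdot>\<^sub>v wa - \<omega> \<cdot>\<^sub>v wb) $ i = 0" "(\<omega> \<cdot>\<^sub>v wa + \<sigma> \<cdot>\<^sub>v wb) $ i = 0"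
          unfolding bottom using i by auto
        then have "\<sigma> * wa $ i - \<omega> * wb $ i = 0" "\<omega> * wa $ i + \<sigma> * wb $ i = 0"
          using i a(2) b(2) by simp_all
        from rotation_scaling_injective[OF this \<mu>pos] show ?thesis by blast
      qed
      then show "wa = 0\<^sub>v k" "wb = 0\<^sub>v k" using a(2) b(2) by (auto intro!: eq_vecI)
    qed
    have BH0: "B *\<^sub>v (H *\<^sub>v 0\<^sub>v k) = 0\<^sub>v n"
    proof -
      have "H *\<^sub>v 0\<^sub>v k = 0\<^sub>v m" "B *\<^sub>v 0\<^sub>v m = 0\<^sub>v n" using H(1) BN by (auto intro!: eq_vecI)
      then show ?thesis by simp
    qed
    have comp: "c1 * (A *\<^sub>v x_df) $ i = (\<sigma> * c1 - \<omega> * c2) * x_df $ i"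
        "c2 * (A *\<^sub>v x_df) $ i = (\<omega> * c1 + \<sigma> * c2) * x_df $ i" if i: "i < n" for i
    proof -
      have "(A *\<^sub>v xa + B *\<^sub>v (H *\<^sub>v wa)) $ i = c1 * (A *\<^sub>v x_df) $ i"
        "(A *\<^sub>v xb + B *\<^sub>v (H *\<^sub>v wb)) $ i = c2 * (A *\<^sub>v x_df) $ i"
        unfolding w0 BH0 c1 c2 using i A(3) x_df(1) by (simp_all add: mult_mat_vec[of A n n])
      then show "c1 * (A *\<^sub>v x_df) $ i = (\<sigma> * c1 - \<omega> * c2) * x_df $ i"
        "c2 * (A *\<^sub>v x_df) $ i = (\<omega> * c1 + \<sigma> * c2) * x_df $ i"
        unfolding top unfolding c1 c2 using i x_df(1) by (simp_all add: algebra_simps)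
    qed
    have cpos: "c1 * c1 + c2 * c2 > 0"
    proof (rule ccontr)
      assume "\<not> ?thesis"
      then have "c1 = 0" "c2 = 0"
        by (auto simp: not_less sum_squares_le_zero_iff)
      then have "map_vec Re v = 0\<^sub>v ?N" "map_vec Im v = 0\<^sub>v ?N"
        unfolding a(3) b(3) w0 c1 c2 using x_df(1) by (auto intro!: eq_vecI)
      then have "v = 0\<^sub>v ?N"
        using vN by (intro complex_vec_eqI) (auto intro!: eq_vecI)
      with v0 show False ..
    qed
    have eig: "A *\<^sub>v x_df = \<sigma> \<cdot>\<^sub>v x_df"
    proof (rule eq_vecI)
      fix i assume "i < dim_vec (\<sigma> \<cdot>\<^sub>v x_df)"
      then have i: "i < n" using x_df(1) by simp
      show "(A *\<^sub>v x_df) $ i = (\<sigma> \<cdot>\<^sub>v x_df) $ i"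
        using rotation_scaling_real_part[OF comp[OF i] cpos] i x_df(1) by simp
    qed (use A(3) x_df(1) in simp)
    have "eigenvector (complexify A) (map_vec complex_of_real x_df) (complex_of_real \<sigma>)"
      by (rule of_real_hom.eigenvector_hom[OF A(3)]) (use A(3) x_df(1,2) eig in \<open>simp add: eigenvector_def\<close>)
    then have "\<not> 0 < \<sigma>" using x_df(4) unfolding V_plus_def by auto
    then have "\<sigma> = 0" using \<mu>(1) unfolding \<sigma>_def by simp
    obtain i where i: "i < n" "x_df $ i \<noteq> 0"
      using x_df(1,2) by (metis carrier_vecD eq_vecI index_zero_vec)
    have "(A *\<^sub>v x_df) $ i = 0" unfolding eig using i x_df(1) \<open>\<sigma> = 0\<close> by simp
    then have "\<omega> * c2 = 0" "\<omega> * c1 = 0" using comp[OF i(1)] i(2) \<open>\<sigma> = 0\<close> by auto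
    then have "\<omega> = 0" using cpos by auto
    with \<open>\<sigma> = 0\<close> \<mu>pos show False by simp
  qed

  show ?thesis
    unfolding drives_to_line_def
  proof (intro allI impI)
    fix x w assume "closed_loop A B H F1 F2 K G P x w"
    note traj = closed_loop_state_equation[OF A(3) BN H(1) F12 KG(1,2) PN this]
    have xt: "x t \<in> carrier_vec n" if "0 \<le> t" for t
      using \<open>closed_loop A B H F1 F2 K G P x w\<close> that A(3)
      unfolding closed_loop_def has_deriv_on_nonneg_def by auto
    from linear_flow_converges[OF MN spectrum semisimple traj]
    obtain l where l: "l \<in> carrier_vec ?N" "?M *\<^sub>v l = 0\<^sub>v ?N" "converges_to ?N (\<lambda>t. x t @\<^sub>v w t) l"
      by blast
    obtain lx lw where lxw: "lx \<in> carrier_vec n" "lw \<in> carrier_vec k" "l = lx @\<^sub>v lw"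
      using append_vec_splitE[OF l(1)] .
    obtain c where c: "lx = c \<cdot>\<^sub>v x_df"
      using on_line[OF lxw(1,2)] kernel_line(1)[OF l(1,2)] lxw(3) by auto
    have "((\<lambda>t. x t $ i) \<longlongrightarrow> lx $ i) at_top" if i: "i < n" for i
    proof -
      have lim: "((\<lambda>t. (x t @\<^sub>v w t) $ i) \<longlongrightarrow> l $ i) at_top"
        using l(3) i unfolding converges_to_def by simp
      have "\<forall>\<^sub>F t in at_top. (x t @\<^sub>v w t) $ i = x t $ i"
        using i by (auto intro!: eventually_at_top_linorderI[of 0] simp: append_vec_def carrier_vecD[OF xt])
      from Lim_transform_eventually[OF lim this] show ?thesis using lxw i by simp
    qed
    then show "\<exists>c. converges_to (dim_row A) x (c \<cdot>\<^sub>v x_df)"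
      using A(3) unfolding converges_to_def c[symmetric] using c by auto
  qed
qed

end
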